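(* Let $P^{(D_n,D_n)}_{(1^r)}(x\,|\,q,t)=P_{(1^r)}(x\,|\,1,-1,q^{1/2},-q^{1/2}\,|\,q,t)$, which is the type $(C_n,C_n)$ one-column Macdonald polynomial $P_{(1^r)}(x\,|\,b^{1/2},-b^{1/2},q^{1/2}b^{1/2},-q^{1/2}b^{1/2}\,|\,q,t)$ at $b=1$, and let $s^{(D_n)}_{(1^r)}(x)=P^{(D_n,D_n)}_{(1^r)}(x\,|\,q,q)$ (the case $b=1$, $t=q$). In this case (that is, for $a=1$, $c=q^{1/2}$, $t=q$) the function $$f(s)=\frac{(1-1/s)\big(1-t^{2}/(s a^2c^2)\big)\big(1+t/(s a^2)\big)\big(1+t/(sc^2)\big)}{\big(1-t/(s^{2}a^2c^2)\big)\big(1-t^{3}/(s^{2}a^2c^2)\big)}$$ satisfies $f(t)=2$ and $f(t^{i+1})=1$ for all $i>0$, and for $0\le r\le n$ $$s^{(D_n)}_{(1^r)}(x)=P^{(D_n,D_n)}_{(1^r)}(x\,|\,q,q)=\sum_{k=0}^{\lfloor r/2\rfloor}\binom{n-r+2k}{k}\,m_{(1^{r-2k})}(x).$$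
   Context: Koornwinder polynomials. Let $n\ge1$, $x=(x_1,\dots,x_n)$, and let $a,b,c,d,q,t$ be generic complex parameters, $|q|<1$; put $\alpha=(abcd/q)^{1/2}$. The group $W_n=\mathbb{Z}_2^n\rtimes\mathfrak{S}_n$ acts on Laurent polynomials by permuting the variables and inverting $x_i\mapsto x_i^{-1}$. For a partition $\lambda=(\lambda_1\ge\dots\ge\lambda_n\ge0)$, $m_\lambda=m_\lambda(x)$ is the sum of the distinct monomials $x^\mu$, $\mu$ in the $W_n$-orbit of $\lambda$. Let $T_{q,x_i}^{\pm1}$ replace $x_i$ by $q^{\pm1}x_i$, and set $$\mathcal{D}_x=\sum_{i=1}^n\frac{(1-ax_i)(1-bx_i)(1-cx_i)(1-dx_i)}{\alpha t^{n-1}(1-x_i^2)(1-qx_i^2)}\prod_{j\ne i}\frac{(1-tx_ix_j)(1-tx_i/x_j)}{(1-x_ix_j)(1-x_i/x_j)}\big(T_{q,x_i}-1\big)$$ $$\qquad+\sum_{i=1}^n\frac{(1-a/x_i)(1-b/x_i)(1-c/x_i)(1-d/x_i)}{\alpha t^{n-1}(1-1/x_i^2)(1-q/x_i^2)}\prod_{j\ne i}\frac{(1-tx_j/x_i)(1-t/(x_ix_j))}{(1-x_j/x_i)(1-1/(x_ix_j))}\big(T_{q,x_i}^{-1}-1\big).$$ The Koornwinder polynomial $P_\lambda(x\,|\,a,b,c,d\,|\,q,t)$ is the unique $W_n$-invariant Laurent polynomial with $P_\lambda=m_\lambda+$ (linear combination of $m_\mu$, $\mu<\lambda$ in dominance order: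 $\mu_1+\dots+\mu_i\le\lambda_1+\dots+\lambda_i$ for all $i$) and $\mathcal{D}_xP_\lambda=d_\lambda P_\lambda$, where $d_\lambda=\sum_{j=1}^n\big(\alpha t^{n-j}q^{\lambda_j}+\alpha^{-1}t^{-n+j}q^{-\lambda_j}-\alpha t^{n-j}-\alpha^{-1}t^{-n+j}\big)$. Here $(1^r)$ is the partition with $r$ parts equal to $1$, $(1^0)=\varnothing$, $m_\varnothing=1$. The polynomials $s^{(D_n)}_{(1^r)}$ are by convention the $W_n$-invariant polynomials above (for $r=n$ no further decomposition under the smaller type $D_n$ Weyl group is made). The values $f(t^{i+1})$ are first regarded as rational functions in $a,c,t$ (substitute $s=t^{i+1}$ and cancel common factors; for $i=0$ the factor $1-t/(a^2c^2)$ cancels) and then specialized. *)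

theory Defs
  imports
    Complex_Main
    "HOL-Library.Poly_Mapping"
    "HOL-Combinatorics.Permutations"
    "HOL-Computational_Algebra.Polynomial_Factorial"
begin

section \<open>Laurent polynomials and the hyperoctahedral group\<close>

text \<open>
  The group algebra of the free abelian group on the variables \<open>x\<^sub>i\<close>, \<open>i :: nat\<close>: a monomial is the
  finitely supported map sending \<open>i\<close> to the exponent of \<open>x\<^sub>i\<close>.  Rational functions are the elements of
  \<open>laurent fract\<close>.  The Laurent polynomials in \<open>x\<^sub>1, \<dots>, x\<^sub>n\<close> are singled out by \<open>laurent_in\<close>.
\<close>

type_synonym laurent = "(nat \<Rightarrow>\<^sub>0 int) \<Rightarrow>\<^sub>0 complex"

definition laurent_in :: "nat \<Rightarrow> laurent \<Rightarrow> bool" where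
  "laurent_in n P \<longleftrightarrow>
     (\<forall>\<nu> \<in> Poly_Mapping.keys P. Poly_Mapping.keys \<nu> \<subseteq> {1..n})"

abbreviation monom_of :: "(nat \<Rightarrow>\<^sub>0 int) \<Rightarrow> laurent" where
  "monom_of \<nu> \<equiv> Poly_Mapping.single \<nu> 1"

abbreviation const_of :: "complex \<Rightarrow> laurent" where
  "const_of c \<equiv> Poly_Mapping.single 0 c"

text \<open>A pair \<open>(\<sigma>, \<epsilon>)\<close> stands for the element \<open>x\<^sub>i \<mapsto> x\<^bsub>\<sigma> i\<^esub>\<^bsup>\<epsilon> i\<^esup>\<close> of \<open>W\<^sub>n\<close>.\<close>

definition in_W :: "nat \<Rightarrow> (nat \<Rightarrow> nat) \<Rightarrow> (nat \<Rightarrow> int) \<Rightarrow> bool" where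
  "in_W n \<sigma> \<epsilon> \<longleftrightarrow> \<sigma> permutes {1..n} \<and> (\<forall>i \<in> {1..n}. \<epsilon> i = 1 \<or> \<epsilon> i = -1)"

definition exponent_act ::
    "(nat \<Rightarrow> nat) \<Rightarrow> (nat \<Rightarrow> int) \<Rightarrow> (nat \<Rightarrow>\<^sub>0 int) \<Rightarrow> (nat \<Rightarrow>\<^sub>0 int)" where
  "exponent_act \<sigma> \<epsilon> \<nu> =
     (\<Sum>i \<in> Poly_Mapping.keys \<nu>. Poly_Mapping.single (\<sigma> i) (\<epsilon> i * Poly_Mapping.lookup \<nu> i))"

definition laurent_act :: "(nat \<Rightarrow> nat) \<Rightarrow> (nat \<Rightarrow> int) \<Rightarrow> laurent \<Rightarrow> laurent" where
  "laurent_act \<sigma> \<epsilon> P =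
     (\<Sum>\<nu> \<in> Poly_Mapping.keys P.
        Poly_Mapping.single (exponent_act \<sigma> \<epsilon> \<nu>) (Poly_Mapping.lookup P \<nu>))"

definition W_invariant :: "nat \<Rightarrow> laurent \<Rightarrow> bool" where
  "W_invariant n P \<longleftrightarrow> (\<forall>\<sigma> \<epsilon>. in_W n \<sigma> \<epsilon> \<longrightarrow> laurent_act \<sigma> \<epsilon> P = P)"


section \<open>Partitions and orbit sums\<close>

text \<open>A partition with at most \<open>n\<close> parts is a function on \<open>nat\<close> with
  \<open>\<kappa> 1 \<ge> \<dots> \<ge> \<kappa> n\<close>, zero outside \<open>{1..n}\<close>.\<close>

definition is_partition :: "nat \<Rightarrow> (nat \<Rightarrow> nat) \<Rightarrow> bool" where
  "is_partition n \<kappa> \<longleftrightarrow>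
     (\<forall>i. i \<notin> {1..n} \<longrightarrow> \<kappa> i = 0) \<and>
     (\<forall>i \<in> {1..n}. \<forall>j \<in> {1..n}. i \<le> j \<longrightarrow> \<kappa> j \<le> \<kappa> i)"

text \<open>The sizes of \<open>\<mu>\<close> and \<open>\<kappa>\<close> are not required to agree.\<close>

definition dominance_less :: "nat \<Rightarrow> (nat \<Rightarrow> nat) \<Rightarrow> (nat \<Rightarrow> nat) \<Rightarrow> bool" where
  "dominance_less n \<mu> \<kappa> \<longleftrightarrow>
     \<mu> \<noteq> \<kappa> \<and> (\<forall>i \<in> {1..n}. (\<Sum>j=1..i. \<mu> j) \<le> (\<Sum>j=1..i. \<kappa> j))"

definition one_column :: "nat \<Rightarrow> nat \<Rightarrow> nat" where
  "one_column r = (\<lambda>i. if i \<in> {1..r} then 1 else 0)"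

definition exponent :: "nat \<Rightarrow> (nat \<Rightarrow> nat) \<Rightarrow> (nat \<Rightarrow>\<^sub>0 int)" where
  "exponent n \<kappa> = (\<Sum>i=1..n. Poly_Mapping.single i (int (\<kappa> i)))"

definition orbit_sum :: "nat \<Rightarrow> (nat \<Rightarrow> nat) \<Rightarrow> laurent" where
  "orbit_sum n \<kappa> =
     (\<Sum>\<nu> \<in> {exponent_act \<sigma> \<epsilon> (exponent n \<kappa>) | \<sigma> \<epsilon>. in_W n \<sigma> \<epsilon>}. monom_of \<nu>)"


section \<open>Koornwinder polynomials\<close>

abbreviation ratfun_const :: "complex \<Rightarrow> laurent fract" where
  "ratfun_const c \<equiv> to_fract (const_of c)"

abbreviation ratfun_var :: "nat \<Rightarrow> laurent fract" where
  "ratfun_var i \<equiv> to_fract (monom_of (Poly_Mapping.single i 1))"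

text \<open>The substitution \<open>x\<^sub>i \<mapsto> p x\<^sub>i\<close>; thus \<open>T\<^bsub>q,x\<^sub>i\<^esub>\<^bsup>-1\<^esup>\<close> is \<open>shift (inverse q) i\<close>.\<close>

definition shift :: "complex \<Rightarrow> nat \<Rightarrow> laurent \<Rightarrow> laurent" where
  "shift p i P = Poly_Mapping.mapp (\<lambda>\<nu> u. p powi Poly_Mapping.lookup \<nu> i * u) P"

text \<open>
  The coefficient of \<open>T\<^bsub>q,x\<^sub>i\<^esub> - 1\<close> is \<open>koornwinder_coeff\<close> at \<open>y = x\<^sub>i\<close>.  Replacing \<open>x\<^sub>i\<close> by
  \<open>1 / x\<^sub>i\<close>, that is \<open>y = 1 / x\<^sub>i\<close>, gives the coefficient of \<open>T\<^bsub>q,x\<^sub>i\<^esub>\<^bsup>-1\<^esup> - 1\<close>.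
\<close>

definition koornwinder_coeff ::
    "nat \<Rightarrow> complex \<Rightarrow> complex \<Rightarrow> complex \<Rightarrow> complex \<Rightarrow> complex \<Rightarrow> complex \<Rightarrow> complex
       \<Rightarrow> nat \<Rightarrow> laurent fract \<Rightarrow> laurent fract" where
  "koornwinder_coeff n \<alpha> a b c d q t i y =
     (1 - ratfun_const a * y) * (1 - ratfun_const b * y) *
     (1 - ratfun_const c * y) * (1 - ratfun_const d * y) /
     (ratfun_const (\<alpha> * t ^ (n - 1)) * (1 - y\<^sup>2) * (1 - ratfun_const q * y\<^sup>2)) *
     (\<Prod>j \<in> {1..n} - {i}.
        (1 - ratfun_const t * y * ratfun_var j) * (1 - ratfun_const t * y / ratfun_var j) /
        ((1 - y * ratfun_var j) * (1 - y / ratfun_var j)))"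

definition koornwinder_operator ::
    "nat \<Rightarrow> complex \<Rightarrow> complex \<Rightarrow> complex \<Rightarrow> complex \<Rightarrow> complex \<Rightarrow> complex \<Rightarrow> complex
       \<Rightarrow> laurent \<Rightarrow> laurent fract" where
  "koornwinder_operator n \<alpha> a b c d q t P =
     (\<Sum>i=1..n. koornwinder_coeff n \<alpha> a b c d q t i (ratfun_var i) *
        (to_fract (shift q i P) - to_fract P)) +
     (\<Sum>i=1..n. koornwinder_coeff n \<alpha> a b c d q t i (1 / ratfun_var i) *
        (to_fract (shift (inverse q) i P) - to_fract P))"

definition koornwinder_eigenvalue ::
    "nat \<Rightarrow> complex \<Rightarrow> complex \<Rightarrow> complex \<Rightarrow> (nat \<Rightarrow> nat) \<Rightarrow> complex" where
  "koornwinder_eigenvalue n \<alpha> q t \<kappa> =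
     (\<Sum>j=1..n. \<alpha> * t ^ (n - j) * q ^ \<kappa> j + inverse (\<alpha> * t ^ (n - j) * q ^ \<kappa> j)
        - \<alpha> * t ^ (n - j) - inverse (\<alpha> * t ^ (n - j)))"

text \<open>
  Operator and eigenvalue are odd in \<open>\<alpha>\<close>, so the choice of the square root defining \<open>\<alpha>\<close> is
  immaterial.
\<close>

definition is_koornwinder ::
    "nat \<Rightarrow> complex \<Rightarrow> complex \<Rightarrow> complex \<Rightarrow> complex \<Rightarrow> complex \<Rightarrow> complex
       \<Rightarrow> (nat \<Rightarrow> nat) \<Rightarrow> laurent \<Rightarrow> bool" where
  "is_koornwinder n a b c d q t \<kappa> P \<longleftrightarrow>
     (let \<alpha> = csqrt (a * b * c * d / q) in
       laurent_in n P \<and> W_invariant n P \<and>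
       (\<exists>u :: (nat \<Rightarrow> nat) \<Rightarrow> complex.
          P = orbit_sum n \<kappa> +
              (\<Sum>\<mu> \<in> {\<mu>. is_partition n \<mu> \<and> dominance_less n \<mu> \<kappa>}.
                 const_of (u \<mu>) * orbit_sum n \<mu>)) \<and>
       koornwinder_operator n \<alpha> a b c d q t P =
         to_fract (const_of (koornwinder_eigenvalue n \<alpha> q t \<kappa>) * P))"

definition koornwinder ::
    "nat \<Rightarrow> complex \<Rightarrow> complex \<Rightarrow> complex \<Rightarrow> complex \<Rightarrow> complex \<Rightarrow> complex
       \<Rightarrow> (nat \<Rightarrow> nat) \<Rightarrow> laurent" where
  "koornwinder n a b c d q t \<kappa> = (THE P. is_koornwinder n a b c d q t \<kappa> P)"

definition macdonald_CC ::
    "nat \<Rightarrow> nat \<Rightarrow> complex \<Rightarrow> complex \<Rightarrow> complex \<Rightarrow> laurent" where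
  "macdonald_CC n r b q t =
     koornwinder n (csqrt b) (- csqrt b) (csqrt q * csqrt b) (- (csqrt q * csqrt b)) q t
       (one_column r)"

definition macdonald_DD :: "nat \<Rightarrow> nat \<Rightarrow> complex \<Rightarrow> complex \<Rightarrow> laurent" where
  "macdonald_DD n r q t = koornwinder n 1 (-1) (csqrt q) (- csqrt q) q t (one_column r)"

definition schur_D :: "nat \<Rightarrow> nat \<Rightarrow> complex \<Rightarrow> laurent" where
  "schur_D n r q = macdonald_DD n r q q"


section \<open>The function f and specialization of rational functions in a, c, t\<close>

definition column_f :: "'k::field \<Rightarrow> 'k \<Rightarrow> 'k \<Rightarrow> 'k \<Rightarrow> 'k" where
  "column_f a c t s =
     (1 - 1 / s) * (1 - t\<^sup>2 / (s * a\<^sup>2 * c\<^sup>2)) * (1 + t / (s * a\<^sup>2)) * (1 + t / (s * c\<^sup>2)) /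
     ((1 - t / (s\<^sup>2 * a\<^sup>2 * c\<^sup>2)) * (1 - t ^ 3 / (s\<^sup>2 * a\<^sup>2 * c\<^sup>2)))"

text \<open>
  Polynomials in \<open>a, c, t\<close> are nested univariate ones, \<open>a\<close> being the innermost variable and \<open>t\<close>
  the outermost.
\<close>

type_synonym poly_act = "complex poly poly poly"

definition var_a :: "poly_act fract" where "var_a = to_fract [:[:[:0, 1:]:]:]"
definition var_c :: "poly_act fract" where "var_c = to_fract [:[:0, 1:]:]"
definition var_t :: "poly_act fract" where "var_t = to_fract [:0, 1:]"

definition eval_act :: "poly_act \<Rightarrow> complex \<Rightarrow> complex \<Rightarrow> complex \<Rightarrow> complex" where
  "eval_act p a c t = poly (poly (poly p [:[:t:]:]) [:c:]) a"

text \<open>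
  \<open>R\<close> is regular at the point \<open>(a, c, t)\<close>, with value \<open>v\<close> there: some representation of \<open>R\<close> as a
  fraction has nonvanishing denominator at the point.
\<close>

definition specializes_to ::
    "poly_act fract \<Rightarrow> complex \<Rightarrow> complex \<Rightarrow> complex \<Rightarrow> complex \<Rightarrow> bool" where
  "specializes_to R a c t v \<longleftrightarrow>
     (\<exists>p p'. R = Fract p p' \<and> eval_act p' a c t \<noteq> 0 \<and>
             v = eval_act p a c t / eval_act p' a c t)"

lemma specializes_to_unique:
  assumes "specializes_to R a c t v" "specializes_to R a c t w"
  shows "v = w"
proof -
  obtain p p' where p: "R = Fract p p'" "eval_act p' a c t \<noteq> 0"
    "v = eval_act p a c t / eval_act p' a c t"
    using assms(1) unfolding specializes_to_def by blast
  obtain r r' where r: "R = Fract r r'" "eval_act r' a c t \<noteq> 0"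
    "w = eval_act r a c t / eval_act r' a c t"
    using assms(2) unfolding specializes_to_def by blast
  have "p' \<noteq> 0" "r' \<noteq> 0"
    using p(2) r(2) by (auto simp: eval_act_def)
  then have "p * r' = r * p'"
    using p(1) r(1) by (simp add: eq_fract(1))
  then have "eval_act p a c t * eval_act r' a c t = eval_act r a c t * eval_act p' a c t"
    unfolding eval_act_def by (metis poly_mult)
  then show ?thesis
    using p(2,3) r(2,3) by (simp add: frac_eq_eq)
qed

end

theory Submission
  imports Defs
begin

text \<open>
  Put \<open>X\<^sub>i = x\<^sub>i + 1/x\<^sub>i\<close> and let \<open>Y\<^sub>i\<close> be \<open>X\<^sub>i\<close> after \<open>x\<^sub>i \<mapsto> q x\<^sub>i\<close> or \<open>x\<^sub>i \<mapsto> x\<^sub>i / q\<close>.  For \<open>(a, b, c, d) =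
  (1, -1, q\<^sup>1\<^sup>/\<^sup>2, -q\<^sup>1\<^sup>/\<^sup>2)\<close> and \<open>t = q\<close> the coefficient of the corresponding shift in the operator is
  \<open>\<Prod>j\<noteq>i. (Y\<^sub>i - X\<^sub>j) / (X\<^sub>i - X\<^sub>j)\<close>.  Lagrange interpolation at the nodes \<open>X\<^sub>i\<close> then shows that the
  operator maps \<open>E(z) = \<Prod>i. (1 + X\<^sub>i z + z\<^sup>2)\<close> to \<open>(q\<^sup>n + q\<^sup>-\<^sup>n) E(z) - q\<^sup>-\<^sup>n E(q z) - q\<^sup>n E(z / q)\<close>.
  Hence the coefficient \<open>e\<^sub>r\<close> of \<open>z\<^sup>r\<close> in \<open>E(z)\<close>, which is the sum of orbit sums with binomial
  coefficients, is an eigenvector with the required eigenvalue.  These eigenvalues are distinct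
  for \<open>0 \<le> r \<le> n\<close> because \<open>0 < \<bar>q\<bar> < 1\<close>, and \<open>e\<^sub>0, \<dots>, e\<^sub>n\<close> is unitriangular in the one-column orbit
  sums, so nothing else of the form \<open>m\<^sub>r + lower\<close> is an eigenvector with this eigenvalue.
\<close>

section \<open>The eigenvalue equation for the generating function\<close>

text \<open>The polynomial \<open>f - smult (coeff f (card S)) N\<close>, with \<open>N\<close> the
  nodal polynomial, agrees with \<open>f\<close> at the nodes and has degree below their number, so
  it is its own Lagrange interpolant. This covers degree equal to the number of nodes, which is the
  degree that arises below.\<close>

lemma lagrange_top_coeff:
  fixes f :: "'a::field poly" and X :: "'i \<Rightarrow> 'a"
  assumes "finite S" "inj_on X S" "degree f \<le> card S"
  shows "(\<Sum>i\<in>S. poly f (X i) * (\<Prod>j\<in>S - {i}. (v - X j) / (X i - X j)))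
       = poly f v - coeff f (card S) * (\<Prod>j\<in>S. v - X j)"
proof -
  let ?n = "card S"
  define N where "N = (\<Prod>j\<in>S. [:- X j, 1:])"
  define L where "L i = (\<Prod>j\<in>S - {i}. smult (1 / (X i - X j)) [:- X j, 1:])" for i
  have degN: "degree N = ?n"
    unfolding N_def by (subst degree_prod_eq_sum_degree) auto
  have "lead_coeff N = 1"
    unfolding N_def by (simp add: lead_coeff_prod)
  with degN have lcN: "coeff N ?n = 1" by simp
  have degL: "degree (L i) < ?n" if "i \<in> S" for i
  proof -
    have "degree (L i) \<le> (\<Sum>j\<in>S - {i}. degree (smult (1 / (X i - X j)) [:- X j, 1:]))"
      unfolding L_def
      using degree_prod_sum_le[of "S - {i}" "\<lambda>j. smult (1 / (X i - X j)) [:- X j, 1:]"] assms(1)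
      by (simp only: o_def finite_Diff)
    also have "\<dots> \<le> (\<Sum>j\<in>S - {i}. 1)"
      by (intro sum_mono) (auto simp: degree_smult_eq)
    also have "\<dots> < ?n"
      using that assms(1) card_Diff1_less[of S i] by simp
    finally show ?thesis .
  qed
  have L: "poly (L i) z = (\<Prod>j\<in>S - {i}. (z - X j) / (X i - X j))" for i z
    unfolding L_def poly_prod by (intro prod.cong refl) (simp add: diff_divide_distrib)
  have polyL: "poly (L i) (X k) = (if i = k then 1 else 0)" if "i \<in> S" "k \<in> S" for i k
  proof (cases "i = k")
    case True
    have "X k - X j \<noteq> 0" if "j \<in> S - {k}" for j
      using that \<open>k \<in> S\<close> inj_onD[OF assms(2), of k j] by auto
    then show ?thesis
      unfolding L using True by (simp add: prod.neutral)
  next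
    case False
    then show ?thesis
      using that assms(1) unfolding L by (auto intro!: prod_zero)
  qed
  have "(\<Sum>i\<in>S. smult (poly f (X i)) (L i)) = f - smult (coeff f ?n) N"
  proof (rule poly_eqI_degree_lead_coeff[where n = ?n and A = "X ` S"])
    show "coeff (\<Sum>i\<in>S. smult (poly f (X i)) (L i)) ?n = coeff (f - smult (coeff f ?n) N) ?n"
      using degL by (simp add: coeff_sum lcN coeff_eq_0)
    show "?n \<le> card (X ` S)"
      using assms(2) by (simp add: card_image)
    show "degree (\<Sum>i\<in>S. smult (poly f (X i)) (L i)) \<le> ?n"
      using degL assms(1)
      by (intro degree_sum_le) (auto intro: order.trans[OF degree_smult_le] less_imp_le)
    show "degree (f - smult (coeff f ?n) N) \<le> ?n"
      using assms(3) degN by (intro degree_diff_le) (auto intro: order.trans[OF degree_smult_le])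
    fix z assume "z \<in> X ` S"
    then obtain k where k: "k \<in> S" "z = X k" by auto
    have "poly N z = 0"
      unfolding N_def poly_prod using k assms(1) by (auto intro!: prod_zero)
    moreover have "poly (\<Sum>i\<in>S. smult (poly f (X i)) (L i)) z = (\<Sum>i\<in>S. if i = k then poly f z else 0)"
      unfolding poly_sum by (intro sum.cong) (auto simp: k polyL)
    ultimately show "poly (\<Sum>i\<in>S. smult (poly f (X i)) (L i)) z = poly (f - smult (coeff f ?n) N) z"
      using k assms(1) by simp
  qed
  then have "poly (\<Sum>i\<in>S. smult (poly f (X i)) (L i)) v = poly (f - smult (coeff f ?n) N) v"
    by simp
  then show ?thesis
    by (simp add: poly_sum L N_def poly_prod)
qed

text \<open>
  The two values \<open>q\<^sup>\<plusminus>\<^sup>1x + 1 / (q\<^sup>\<plusminus>\<^sup>1x)\<close> have sum \<open>(q + 1/q) w\<close> and product \<open>q\<^sup>2 + 1/q\<^sup>2 - 2 + w\<^sup>2\<close>, where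
  \<open>w = x + 1/x\<close>; the recursion is Newton's recursion for their power sums.
\<close>

fun powersum_poly :: "'a::field \<Rightarrow> nat \<Rightarrow> 'a poly" where
  "powersum_poly q 0 = [:2:]"
| "powersum_poly q (Suc 0) = [:0, q + 1 / q:]"
| "powersum_poly q (Suc (Suc m)) =
     [:0, q + 1 / q:] * powersum_poly q (Suc m) - [:q\<^sup>2 + 1 / q\<^sup>2 - 2, 0, 1:] * powersum_poly q m"

lemma degree_powersum_poly: "degree (powersum_poly q m) \<le> m"
proof (induction q m rule: powersum_poly.induct)
  case (3 q m)
  have "degree ([:0, q + 1 / q:] * powersum_poly q (Suc m)) \<le> 1 + Suc m"
    by (rule order.trans[OF degree_mult_le]) (intro add_mono 3, simp)
  moreover have "degree ([:q\<^sup>2 + 1 / q\<^sup>2 - 2, 0, 1:] * powersum_poly q m) \<le> 2 + m"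
    by (rule order.trans[OF degree_mult_le]) (intro add_mono 3, simp)
  ultimately show ?case by (simp add: degree_diff_le)
qed simp_all

text \<open>In top degree the recursion reads
  \<open>c (m + 2) = (q + 1 / q) * c (m + 1) - c m\<close>. With the initial values \<open>2\<close>
  and \<open>q + 1 / q\<close> its solution is \<open>q ^ m + 1 / q ^ m\<close>.\<close>

lemma coeff_powersum_poly:
  assumes "q \<noteq> 0"
  shows "coeff (powersum_poly q m) m = q ^ m + 1 / q ^ m"
  using assms
proof (induction q m rule: powersum_poly.induct)
  case (3 q m)
  have "coeff (powersum_poly q m) (Suc (Suc m)) = 0" "coeff (powersum_poly q m) (Suc m) = 0"
    "coeff (powersum_poly q (Suc m)) (Suc (Suc m)) = 0"
    by (intro coeff_eq_0 le_less_trans[OF degree_powersum_poly]; simp)+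
  then have "coeff (powersum_poly q (Suc (Suc m))) (Suc (Suc m))
      = (q + 1 / q) * (q ^ Suc m + 1 / q ^ Suc m) - (q ^ m + 1 / q ^ m)"
    using 3 by (simp add: numeral_2_eq_2)
  also have "\<dots> = q ^ Suc (Suc m) + 1 / q ^ Suc (Suc m)"
    using 3 by (simp add: field_simps power2_eq_square)
  finally show ?case .
qed simp_all

lemma poly_powersum_poly:
  assumes "q \<noteq> 0" "x \<noteq> 0"
  shows "poly (powersum_poly q m) (x + 1 / x)
       = (q * x + 1 / (q * x)) ^ m + (x / q + q / x) ^ m"
  using assms(1)
proof (induction q m rule: powersum_poly.induct)
  case (2 q)
  then show ?case using assms(2) by (simp add: field_simps)
next
  case (3 q m)
  define a b where "a = q * x + 1 / (q * x)" and "b = x / q + q / x"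
  have "(x + 1 / x) * (q + 1 / q) = a + b"
    using 3 assms(2) by (simp add: a_def b_def field_simps)
  moreover have "q\<^sup>2 + 1 / q\<^sup>2 - 2 + (x + 1 / x) * (x + 1 / x) = a * b"
    using 3 assms(2) by (simp add: a_def b_def field_simps power2_eq_square)
  moreover have "poly (powersum_poly q (Suc (Suc m))) w
      = (w * (q + 1 / q)) * poly (powersum_poly q (Suc m)) w
        - (q\<^sup>2 + 1 / q\<^sup>2 - 2 + w * w) * poly (powersum_poly q m) w" for w
    by (simp add: algebra_simps)
  ultimately have "poly (powersum_poly q (Suc (Suc m))) (x + 1 / x)
      = (a + b) * poly (powersum_poly q (Suc m)) (x + 1 / x) - a * b * poly (powersum_poly q m) (x + 1 / x)"
    by (simp only:)
  also have "\<dots> = (a + b) * (a ^ Suc m + b ^ Suc m) - a * b * (a ^ m + b ^ m)"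
    using 3 unfolding a_def[symmetric] b_def[symmetric] by simp
  also have "\<dots> = a ^ Suc (Suc m) + b ^ Suc (Suc m)"
    by (simp add: algebra_simps)
  finally show ?case by (simp only: a_def b_def)
qed simp

text \<open>Expanding \<open>f\<close> in powers reduces the claim to the power sums of the two
  shifted values. The result merges the forward and the backward shift into one polynomial in
  \<open>x + 1 / x\<close>, ready for interpolation.\<close>

lemma symmetric_shift_poly:
  fixes f :: "'a::field poly"
  assumes "q \<noteq> 0"
  obtains g where "degree g \<le> degree f"
    "coeff g (degree f) = (q ^ degree f + 1 / q ^ degree f) * lead_coeff f"
    "\<And>x. x \<noteq> 0 \<Longrightarrow> poly g (x + 1 / x) = poly f (q * x + 1 / (q * x)) + poly f (x / q + q / x)"
proof
  let ?n = "degree f"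
  define g where "g = (\<Sum>m\<le>?n. smult (coeff f m) (powersum_poly q m))"
  show "degree g \<le> ?n"
    unfolding g_def
    by (intro degree_sum_le)
      (auto intro!: order.trans[OF degree_smult_le] order.trans[OF degree_powersum_poly])
  have "coeff g ?n = (\<Sum>m\<le>?n. if m = ?n then coeff f ?n * coeff (powersum_poly q ?n) ?n else 0)"
    unfolding g_def coeff_sum
    by (intro sum.cong) (auto intro!: coeff_eq_0 le_less_trans[OF degree_powersum_poly])
  then show "coeff g ?n = (q ^ ?n + 1 / q ^ ?n) * lead_coeff f"
    using assms by (simp add: coeff_powersum_poly)
  show "poly g (x + 1 / x) = poly f (q * x + 1 / (q * x)) + poly f (x / q + q / x)"
    if "x \<noteq> 0" for x
    using that assms unfolding g_def
    by (simp add: poly_sum poly_powersum_poly poly_altdef[of f] ring_distribs sum.distrib)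
qed

section \<open>The generating function identity over an infinite field\<close>

lemma prod_one_minus:
  fixes u :: "'a::field"
  assumes "u \<noteq> 0"
  shows "(\<Prod>j\<in>A. 1 - u * X j + u\<^sup>2) = u ^ card A * (\<Prod>j\<in>A. u + 1 / u - X j)"
proof -
  have "1 - u * X j + u\<^sup>2 = u * (u + 1 / u - X j)" for j
    using assms by (simp add: field_simps power2_eq_square)
  then show ?thesis by (simp add: prod.distrib)
qed

text \<open>Both sides are polynomials in \<open>z\<close> and are compared at
  \<open>z = - u\<close> for all nonzero \<open>u\<close>, which suffices because the field is
  infinite. At such a point the left side is a Lagrange sum evaluated at
  \<open>u + 1 / u\<close>.\<close>

lemma generating_function_eigen:
  fixes x X Yp Ym :: "'i \<Rightarrow> 'a::field"
  assumes inf: "infinite (UNIV :: 'a set)" and q: "q \<noteq> 0"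
    and S: "finite S" and x: "\<And>i. i \<in> S \<Longrightarrow> x i \<noteq> 0"
    and X: "\<And>i. X i = x i + 1 / x i" and inj: "inj_on X S"
    and Yp: "\<And>i. Yp i = q * x i + 1 / (q * x i)" and Ym: "\<And>i. Ym i = x i / q + q / x i"
  defines "E \<equiv> (\<Prod>i\<in>S. [:1, X i, 1:])"
  shows "(\<Sum>i\<in>S. smult (\<Prod>j\<in>S - {i}. (Yp i - X j) / (X i - X j))
                     ([:1, Yp i, 1:] * (\<Prod>j\<in>S - {i}. [:1, X j, 1:]) - E))
       + (\<Sum>i\<in>S. smult (\<Prod>j\<in>S - {i}. (Ym i - X j) / (X i - X j))
                     ([:1, Ym i, 1:] * (\<Prod>j\<in>S - {i}. [:1, X j, 1:]) - E))
       = smult (q ^ card S + 1 / q ^ card S) E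
       - (smult (1 / q ^ card S) (pcompose E [:0, q:]) + smult (q ^ card S) (pcompose E [:0, 1 / q:]))"
    (is "?L = ?R")
proof -
  let ?n = "card S"
  define N where "N = (\<Prod>j\<in>S. [:- X j, 1:])"
  have polyN: "poly N v = (\<Prod>j\<in>S. v - X j)" for v
    by (simp add: N_def poly_prod)
  have degN: "degree N = ?n"
    unfolding N_def by (subst degree_prod_eq_sum_degree) auto
  have lcN: "lead_coeff N = 1"
    unfolding N_def by (simp add: lead_coeff_prod)
  obtain f where degf: "degree f \<le> ?n" and cf: "coeff f ?n = q ^ ?n + 1 / q ^ ?n"
    and f: "\<And>x. x \<noteq> 0 \<Longrightarrow> poly f (x + 1 / x) = poly N (q * x + 1 / (q * x)) + poly N (x / q + q / x)"
    using symmetric_shift_poly[OF q, of N] unfolding degN lcN lcN[unfolded degN] by auto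
  \<comment> \<open>The substitution turns \<open>1 + X i * z + z^2\<close> into
    \<open>u * (u + 1 / u - X i)\<close>, and hence \<open>E\<close> into the nodal
    polynomial.\<close>
  have E: "poly E (- u) = u ^ ?n * poly N (u + 1 / u)" if "u \<noteq> 0" for u
    using prod_one_minus[OF that, of X S]
    by (simp add: E_def polyN poly_prod algebra_simps power2_eq_square)
  have EX: "E = [:1, X i, 1:] * (\<Prod>j\<in>S - {i}. [:1, X j, 1:])" if "i \<in> S" for i
    unfolding E_def using S that by (simp add: prod.remove)
  have eq: "poly ?L (- u) = poly ?R (- u)" if u: "u \<noteq> 0" for u
  proof -
    define v where "v = u + 1 / u"
    \<comment> \<open>The difference of generating functions contributes the factor
      \<open>Y - X i\<close> missing from the numerator
      \<open>\<Prod>j\<in>S - {i}. Y - X j\<close>, completing it to \<open>N\<close> at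
      \<open>Y\<close>. The unchanged factors of \<open>E\<close> become the numerator of the
      Lagrange basis polynomial at \<open>v\<close>.\<close>
    have step: "(\<Prod>j\<in>S - {i}. (Y - X j) / (X i - X j)) *
          poly ([:1, Y, 1:] * (\<Prod>j\<in>S - {i}. [:1, X j, 1:]) - E) (- u)
        = - (u ^ ?n) * (poly N Y * (\<Prod>j\<in>S - {i}. (v - X j) / (X i - X j)))" if i: "i \<in> S" for i Y
    proof -
      have "poly ([:1, Y, 1:] * (\<Prod>j\<in>S - {i}. [:1, X j, 1:]) - E) (- u)
          = - (u * (Y - X i)) * (\<Prod>j\<in>S - {i}. 1 - u * X j + u\<^sup>2)"
        unfolding EX[OF i] by (simp add: poly_prod algebra_simps power2_eq_square)
      also have "\<dots> = - (u ^ Suc (card (S - {i}))) * (Y - X i) * (\<Prod>j\<in>S - {i}. v - X j)"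
        using prod_one_minus[OF u, of X "S - {i}"] by (simp add: v_def)
      also have "Suc (card (S - {i})) = ?n"
        using S i by (metis card_Suc_Diff1)
      finally have 1: "poly ([:1, Y, 1:] * (\<Prod>j\<in>S - {i}. [:1, X j, 1:]) - E) (- u)
          = - (u ^ ?n) * (Y - X i) * (\<Prod>j\<in>S - {i}. v - X j)" .
      have 2: "poly N Y = (Y - X i) * (\<Prod>j\<in>S - {i}. Y - X j)"
        unfolding polyN using S i by (simp add: prod.remove)
      show ?thesis
        unfolding 1 2 by (simp add: prod_dividef)
    qed
    have "poly ?L (- u) = - (u ^ ?n) * (\<Sum>i\<in>S. poly f (X i) * (\<Prod>j\<in>S - {i}. (v - X j) / (X i - X j)))"
      unfolding poly_add poly_sum poly_smult sum_distrib_left sum.distrib[symmetric]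
    proof (intro sum.cong refl)
      fix i assume i: "i \<in> S"
      have fX: "poly f (X i) = poly N (Yp i) + poly N (Ym i)"
        using f[OF x[OF i]] by (simp only: X Yp Ym)
      show "(\<Prod>j\<in>S - {i}. (Yp i - X j) / (X i - X j)) *
            poly ([:1, Yp i, 1:] * (\<Prod>j\<in>S - {i}. [:1, X j, 1:]) - E) (- u) +
            (\<Prod>j\<in>S - {i}. (Ym i - X j) / (X i - X j)) *
            poly ([:1, Ym i, 1:] * (\<Prod>j\<in>S - {i}. [:1, X j, 1:]) - E) (- u)
          = - (u ^ ?n) * (poly f (X i) * (\<Prod>j\<in>S - {i}. (v - X j) / (X i - X j)))"
        unfolding step[OF i] fX by (simp add: algebra_simps)
    qed
    \<comment> \<open>The correction for the top coefficient of \<open>f\<close> is what yields the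
      multiple of \<open>E\<close> itself on the right side.\<close>
    also have "\<dots> = - (u ^ ?n) * (poly f v - (q ^ ?n + 1 / q ^ ?n) * poly N v)"
      using lagrange_top_coeff[OF S inj degf, of v] by (simp add: cf polyN)
    also have "\<dots> = poly ?R (- u)"
    proof -
      \<comment> \<open>The value of \<open>f\<close> at \<open>v\<close> splits into
        \<open>N\<close> at the two shifts of \<open>u\<close>. The factors
        \<open>(q * u) ^ n\<close> and \<open>(u / q) ^ n\<close> explain why \<open>E(q z)\<close>
        comes with \<open>q ^ (-n)\<close> and \<open>E(z / q)\<close> with
        \<open>q ^ n\<close>.\<close>
      have "poly E (- (q * u)) = (q * u) ^ ?n * poly N (q * u + 1 / (q * u))"
        "poly E (- (u / q)) = (u / q) ^ ?n * poly N (u / q + q / u)"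
        using E[of "q * u"] E[of "u / q"] q u by auto
      then show ?thesis
        using q f[OF u] E[OF u]
        by (simp add: poly_pcompose v_def power_mult_distrib power_divide mult.commute[of u]) (simp add: field_simps)
    qed
    finally show ?thesis .
  qed
  have "UNIV - {0} \<subseteq> {z. poly (?L - ?R) z = 0}"
    using eq[of "- z" for z] by (auto simp del: poly_sum)
  then have "infinite {z. poly (?L - ?R) z = 0}"
    using inf finite_subset by fastforce
  then have "?L - ?R = 0"
    using poly_roots_finite by blast
  then show ?thesis by simp
qed

section \<open>One-column orbit sums\<close>

lemma poly_mapping_sum_single:
  fixes P :: "'a \<Rightarrow>\<^sub>0 'b::comm_monoid_add"
  shows "P = (\<Sum>\<nu>\<in>Poly_Mapping.keys P. Poly_Mapping.single \<nu> (Poly_Mapping.lookup P \<nu>))"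
  by (rule poly_mapping_eqI) (simp add: lookup_sum lookup_single when_def in_keys_iff)

lemma poly_mapping_single_induct [case_names single add]:
  fixes P :: "'a \<Rightarrow>\<^sub>0 'b::comm_monoid_add"
  assumes "\<And>\<nu> c. Q (Poly_Mapping.single \<nu> c)" "\<And>a b. Q a \<Longrightarrow> Q b \<Longrightarrow> Q (a + b)"
  shows "Q P"
proof -
  \<comment> \<open>The zero map is \<open>single undefined 0\<close>, so the empty sum falls under
    the case of a single monomial.\<close>
  have "Q (\<Sum>\<nu>\<in>A. Poly_Mapping.single \<nu> (Poly_Mapping.lookup P \<nu>))" for A
    using assms(1)[of undefined 0] by (induction A rule: infinite_finite_induct) (auto intro: assms)
  then show ?thesis
    by (subst poly_mapping_sum_single)
qed

lemma lookup_const_mult: "Poly_Mapping.lookup (const_of c * P) \<nu> = c * Poly_Mapping.lookup P \<nu>"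
  by (induction P rule: poly_mapping_single_induct)
    (simp_all add: mult_single lookup_single when_def lookup_add algebra_simps)

lemma const_of_mult: "const_of (c * d) = const_of c * const_of d"
  by (simp add: mult_single)

lemma lookup_shift: "Poly_Mapping.lookup (shift p i P) \<nu> = p powi Poly_Mapping.lookup \<nu> i * Poly_Mapping.lookup P \<nu>"
  by (simp add: shift_def lookup_mapp when_def in_keys_iff)

lemma shift_single: "shift p i (Poly_Mapping.single \<nu> c) = Poly_Mapping.single \<nu> (p powi Poly_Mapping.lookup \<nu> i * c)"
  by (rule poly_mapping_eqI) (simp add: lookup_shift lookup_single when_def)

lemma shift_add: "shift p i (P + Q) = shift p i P + shift p i Q"
  by (rule poly_mapping_eqI) (simp add: lookup_shift lookup_add algebra_simps)

lemma shift_const_mult: "shift p i (const_of c * P) = const_of c * shift p i P"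
  by (rule poly_mapping_eqI) (simp add: lookup_shift lookup_const_mult)

text \<open>On monomials this is the law \<open>p powi (k + l) = p powi k * p powi l\<close>, which
  fails at \<open>p = 0\<close> for opposite exponents. The general case follows by
  bilinearity.\<close>

lemma shift_mult:
  assumes "p \<noteq> 0"
  shows "shift p i (P * Q) = shift p i P * shift p i Q"
proof (induction P rule: poly_mapping_single_induct)
  case (single \<nu> c)
  show ?case
    using assms
    by (induction Q rule: poly_mapping_single_induct)
      (simp_all add: shift_single mult_single lookup_add power_int_add shift_add algebra_simps)
qed (simp add: shift_add algebra_simps)

lemma shift_0: "shift p i 0 = 0"
  by (rule poly_mapping_eqI) (simp add: lookup_shift)

lemma shift_1: "shift p i 1 = 1"
  using shift_single[of p i 0 1] by simp

section \<open>The orbit of a column under the hyperoctahedral group\<close>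

lemma lookup_exponent:
  "Poly_Mapping.lookup (exponent n \<kappa>) i = (if i \<in> {1..n} then int (\<kappa> i) else 0)"
  by (simp add: exponent_def lookup_sum lookup_single when_def)

lemma lookup_exponent_act:
  assumes "inj \<sigma>"
  shows "Poly_Mapping.lookup (exponent_act \<sigma> \<epsilon> \<nu>) (\<sigma> i) = \<epsilon> i * Poly_Mapping.lookup \<nu> i"
  using assms by (simp add: exponent_act_def lookup_sum lookup_single when_def inj_eq in_keys_iff)

text \<open>An intrinsic description of the orbit of \<open>exponent n (one_column k)\<close>; the
  two are identified in \<open>orbit_one_column\<close>.\<close>

definition column_orbit :: "nat \<Rightarrow> nat \<Rightarrow> (nat \<Rightarrow>\<^sub>0 int) set" where
  "column_orbit n k = {\<nu>. Poly_Mapping.keys \<nu> \<subseteq> {1..n} \<and> card (Poly_Mapping.keys \<nu>) = k \<and>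
     (\<forall>i\<in>Poly_Mapping.keys \<nu>. Poly_Mapping.lookup \<nu> i \<in> {1, -1})}"

lemma keys_exponent_act:
  assumes "in_W n \<sigma> \<epsilon>" "Poly_Mapping.keys \<nu> \<subseteq> {1..n}"
  shows "Poly_Mapping.keys (exponent_act \<sigma> \<epsilon> \<nu>) = \<sigma> ` Poly_Mapping.keys \<nu>"
proof -
  have \<sigma>: "\<sigma> permutes {1..n}" and \<epsilon>: "\<And>i. i \<in> {1..n} \<Longrightarrow> \<epsilon> i \<noteq> 0"
    using assms(1) by (force simp: in_W_def)+
  have "j \<in> Poly_Mapping.keys (exponent_act \<sigma> \<epsilon> \<nu>) \<longleftrightarrow> j \<in> \<sigma> ` Poly_Mapping.keys \<nu>" for j
  proof -
    obtain i where i: "j = \<sigma> i"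
      using permutes_surj[OF \<sigma>] by (metis surjD)
    show ?thesis
      unfolding i using assms(2) \<epsilon> permutes_inj[OF \<sigma>]
      by (auto simp: in_keys_iff lookup_exponent_act inj_image_mem_iff)
  qed
  then show ?thesis by blast
qed

lemma exponent_act_column_orbit:
  assumes "in_W n \<sigma> \<epsilon>" "\<nu> \<in> column_orbit n k"
  shows "exponent_act \<sigma> \<epsilon> \<nu> \<in> column_orbit n k"
proof -
  have \<sigma>: "\<sigma> permutes {1..n}" and \<epsilon>: "\<And>i. i \<in> {1..n} \<Longrightarrow> \<epsilon> i \<in> {1, -1}"
    using assms(1) by (auto simp: in_W_def)
  have \<nu>: "Poly_Mapping.keys \<nu> \<subseteq> {1..n}" "card (Poly_Mapping.keys \<nu>) = k"
    "\<And>i. i \<in> Poly_Mapping.keys \<nu> \<Longrightarrow> Poly_Mapping.lookup \<nu> i \<in> {1, -1}"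
    using assms(2) by (auto simp: column_orbit_def)
  have inj: "inj \<sigma>" using permutes_inj[OF \<sigma>] .
  have "\<sigma> ` Poly_Mapping.keys \<nu> \<subseteq> {1..n}"
    using \<nu>(1) permutes_image[OF \<sigma>] by blast
  moreover have "card (\<sigma> ` Poly_Mapping.keys \<nu>) = k"
    using \<nu>(2) inj by (simp add: card_image inj_on_subset)
  moreover have "Poly_Mapping.lookup (exponent_act \<sigma> \<epsilon> \<nu>) (\<sigma> i) \<in> {1, -1}"
    if "i \<in> Poly_Mapping.keys \<nu>" for i
    using \<nu>(3)[OF that] \<epsilon>[of i] \<nu>(1) that by (auto simp: lookup_exponent_act[OF inj])
  ultimately show ?thesis
    unfolding column_orbit_def mem_Collect_eq keys_exponent_act[OF assms(1) \<nu>(1)] by blast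
qed

lemma keys_exponent_one_column:
  assumes "k \<le> n"
  shows "Poly_Mapping.keys (exponent n (one_column k)) = {1..k}"
  using assms by (auto simp: in_keys_iff lookup_exponent one_column_def split: if_splits)

lemma exponent_one_column_in_orbit:
  assumes "k \<le> n"
  shows "exponent n (one_column k) \<in> column_orbit n k"
  unfolding column_orbit_def mem_Collect_eq keys_exponent_one_column[OF assms]
  using assms by (auto simp: lookup_exponent one_column_def)

text \<open>A bijection from \<open>A\<close> to \<open>B\<close> and one between the complements in
  \<open>S\<close> are glued together, with the identity outside \<open>S\<close>.\<close>

lemma exists_permutation_image:
  assumes "finite S" "A \<subseteq> S" "B \<subseteq> S" "card A = card B"
  obtains \<sigma> where "\<sigma> permutes S" "\<sigma> ` A = B"
proof -
  have fin: "finite A" "finite B" using assms finite_subset by blast+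
  obtain f where f: "bij_betw f A B"
    using finite_same_card_bij[OF fin assms(4)] by blast
  have "card (S - A) = card (S - B)"
    using assms fin by (simp add: card_Diff_subset)
  then obtain g where g: "bij_betw g (S - A) (S - B)"
    using finite_same_card_bij[of "S - A" "S - B"] assms(1) by blast
  define \<sigma> where "\<sigma> x = (if x \<in> A then f x else if x \<in> S then g x else x)" for x
  have 1: "bij_betw \<sigma> A B"
    using f by (rule bij_betw_cong[THEN iffD1, rotated]) (simp add: \<sigma>_def)
  have 2: "bij_betw \<sigma> (S - A) (S - B)"
    using g by (rule bij_betw_cong[THEN iffD1, rotated]) (simp add: \<sigma>_def)
  have "bij_betw \<sigma> (A \<union> (S - A)) (B \<union> (S - B))"
    by (rule bij_betw_combine[OF 1 2]) blast
  then have "bij_betw \<sigma> S S"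
    using assms(2,3) by (simp add: Un_absorb1)
  then have "\<sigma> permutes S"
    by (rule bij_imp_permutes) (use assms(2) in \<open>auto simp: \<sigma>_def\<close>)
  with 1 show ?thesis
    using that bij_betw_imp_surj_on by blast
qed

lemma orbit_one_column:
  assumes "k \<le> n"
  shows "{exponent_act \<sigma> \<epsilon> (exponent n (one_column k)) | \<sigma> \<epsilon>. in_W n \<sigma> \<epsilon>} = column_orbit n k"
    (is "?O = _")
proof
  show "?O \<subseteq> column_orbit n k"
    using exponent_act_column_orbit exponent_one_column_in_orbit[OF assms] by blast
  show "column_orbit n k \<subseteq> ?O"
  proof
    fix \<nu> assume "\<nu> \<in> column_orbit n k"
    then have \<nu>: "Poly_Mapping.keys \<nu> \<subseteq> {1..n}" "card (Poly_Mapping.keys \<nu>) = k"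
      "\<And>i. i \<in> Poly_Mapping.keys \<nu> \<Longrightarrow> Poly_Mapping.lookup \<nu> i \<in> {1, -1}"
      by (auto simp: column_orbit_def)
    obtain \<sigma> where \<sigma>: "\<sigma> permutes {1..n}" "\<sigma> ` {1..k} = Poly_Mapping.keys \<nu>"
      using exists_permutation_image[of "{1..n}" "{1..k}" "Poly_Mapping.keys \<nu>"] assms \<nu> by auto
    \<comment> \<open>The action carries the entry at \<open>i\<close> to position
      \<open>\<sigma> i\<close>, so the sign is read off there. The value \<open>1\<close> elsewhere
      keeps \<open>\<epsilon>\<close> a vector of signs and only multiplies zero entries.\<close>
    define \<epsilon> where "\<epsilon> i = (if i \<in> {1..k} then Poly_Mapping.lookup \<nu> (\<sigma> i) else 1)" for i
    have "\<sigma> i \<in> Poly_Mapping.keys \<nu>" if "i \<in> {1..k}" for i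
      using \<sigma>(2) that by blast
    then have W: "in_W n \<sigma> \<epsilon>"
      using \<sigma>(1) \<nu>(3) unfolding in_W_def \<epsilon>_def by force
    have inj: "inj \<sigma>" using permutes_inj[OF \<sigma>(1)] .
    have "\<nu> = exponent_act \<sigma> \<epsilon> (exponent n (one_column k))"
    proof (rule poly_mapping_eqI)
      fix j
      obtain i where i: "j = \<sigma> i"
        using permutes_surj[OF \<sigma>(1)] by (metis surjD)
      have "i \<in> {1..k} \<longleftrightarrow> \<sigma> i \<in> Poly_Mapping.keys \<nu>"
        unfolding \<sigma>(2)[symmetric] by (simp add: inj_image_mem_iff[OF inj])
      then show "Poly_Mapping.lookup \<nu> j
          = Poly_Mapping.lookup (exponent_act \<sigma> \<epsilon> (exponent n (one_column k))) j"
        unfolding i lookup_exponent_act[OF inj] lookup_exponent using assms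
        by (auto simp: \<epsilon>_def one_column_def in_keys_iff)
    qed
    then show "\<nu> \<in> ?O" using W by blast
  qed
qed

lemma finite_column_orbit: "finite (column_orbit n k)"
proof -
  have "inj_on Poly_Mapping.lookup (column_orbit n k)"
    by (simp add: inj_on_def poly_mapping.lookup_inject)
  moreover have "Poly_Mapping.lookup ` column_orbit n k
      \<subseteq> {f. \<forall>i. (i \<in> {1..n} \<longrightarrow> f i \<in> {0, 1, -1}) \<and> (i \<notin> {1..n} \<longrightarrow> f i = 0)}"
    by (force simp: column_orbit_def in_keys_iff)
  moreover have "finite {f :: nat \<Rightarrow> int. \<forall>i. (i \<in> {1..n} \<longrightarrow> f i \<in> {0, 1, -1}) \<and> (i \<notin> {1..n} \<longrightarrow> f i = 0)}"
    by (rule finite_set_of_finite_funs) auto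
  ultimately show ?thesis
    using finite_imageD finite_subset by blast
qed

lemma orbit_sum_one_column:
  "k \<le> n \<Longrightarrow> orbit_sum n (one_column k) = (\<Sum>\<nu>\<in>column_orbit n k. monom_of \<nu>)"
  by (simp add: orbit_sum_def orbit_one_column)

section \<open>Invariance, support and leading coefficients of the orbit sums\<close>

lemma laurent_act_single: "laurent_act \<sigma> \<epsilon> (Poly_Mapping.single \<nu> c) = Poly_Mapping.single (exponent_act \<sigma> \<epsilon> \<nu>) c"
  by (cases "c = 0") (simp_all add: laurent_act_def)

lemma laurent_act_add: "laurent_act \<sigma> \<epsilon> (P + Q) = laurent_act \<sigma> \<epsilon> P + laurent_act \<sigma> \<epsilon> Q"
proof -
  let ?K = "Poly_Mapping.keys P \<union> Poly_Mapping.keys Q"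
  \<comment> \<open>Cancellation can make the keys of a sum smaller than the union, so all three
    actions are written as sums over one common index set.\<close>
  have K: "laurent_act \<sigma> \<epsilon> R = (\<Sum>\<nu>\<in>?K. Poly_Mapping.single (exponent_act \<sigma> \<epsilon> \<nu>) (Poly_Mapping.lookup R \<nu>))"
    if "Poly_Mapping.keys R \<subseteq> ?K" for R
    unfolding laurent_act_def using that by (intro sum.mono_neutral_left) (auto simp: in_keys_iff)
  show ?thesis
    using keys_add[of P Q] by (simp add: K lookup_add single_add sum.distrib)
qed

lemma laurent_act_sum: "laurent_act \<sigma> \<epsilon> (\<Sum>i\<in>A. F i) = (\<Sum>i\<in>A. laurent_act \<sigma> \<epsilon> (F i))"
proof -
  have "laurent_act \<sigma> \<epsilon> 0 = 0" by (simp add: laurent_act_def)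
  then show ?thesis
    by (induction A rule: infinite_finite_induct) (simp_all add: laurent_act_add)
qed

lemma W_invariant_sum:
  assumes "\<And>i. i \<in> A \<Longrightarrow> W_invariant n (F i)"
  shows "W_invariant n (\<Sum>i\<in>A. F i)"
  using assms by (simp add: W_invariant_def laurent_act_sum)

lemma W_invariant_of_nat_mult:
  assumes "W_invariant n P"
  shows "W_invariant n (of_nat m * P)"
  using W_invariant_sum[of "{..<m}" n "\<lambda>_. P"] assms by simp

text \<open>A group element acts injectively on exponents supported in \<open>{1..n}\<close> and
  maps the finite orbit into itself, so it permutes the monomials of the orbit sum.\<close>

lemma W_invariant_orbit_sum_one_column:
  assumes "k \<le> n"
  shows "W_invariant n (orbit_sum n (one_column k))"
  unfolding W_invariant_def
proof (intro allI impI)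
  fix \<sigma> \<epsilon> assume W: "in_W n \<sigma> \<epsilon>"
  then have \<sigma>: "\<sigma> permutes {1..n}" by (simp add: in_W_def)
  have inj: "inj_on (exponent_act \<sigma> \<epsilon>) (column_orbit n k)"
  proof (rule inj_onI)
    fix \<mu> \<nu> assume *: "\<mu> \<in> column_orbit n k" "\<nu> \<in> column_orbit n k"
      "exponent_act \<sigma> \<epsilon> \<mu> = exponent_act \<sigma> \<epsilon> \<nu>"
    have "\<epsilon> i * Poly_Mapping.lookup \<mu> i = \<epsilon> i * Poly_Mapping.lookup \<nu> i" for i
      using lookup_exponent_act[OF permutes_inj[OF \<sigma>]] *(3) by metis
    moreover have "\<epsilon> i \<noteq> 0" if "i \<in> {1..n}" for i
      using W that by (force simp: in_W_def)
    moreover have "Poly_Mapping.lookup \<mu> i = 0" "Poly_Mapping.lookup \<nu> i = 0" if "i \<notin> {1..n}" for i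
      using *(1,2) that by (auto simp: column_orbit_def in_keys_iff subset_iff)
    ultimately have "Poly_Mapping.lookup \<mu> i = Poly_Mapping.lookup \<nu> i" for i
      by (metis mult_left_cancel)
    then show "\<mu> = \<nu>" by (rule poly_mapping_eqI)
  qed
  have "exponent_act \<sigma> \<epsilon> ` column_orbit n k = column_orbit n k"
    using exponent_act_column_orbit[OF W] inj
    by (intro endo_inj_surj finite_column_orbit) auto
  with inj show "laurent_act \<sigma> \<epsilon> (orbit_sum n (one_column k)) = orbit_sum n (one_column k)"
    unfolding orbit_sum_one_column[OF assms] laurent_act_sum laurent_act_single
    by (metis (no_types, lifting) sum.reindex_cong)
qed

lemma laurent_in_sum:
  assumes "\<And>i. i \<in> A \<Longrightarrow> laurent_in n (F i)"
  shows "laurent_in n (\<Sum>i\<in>A. F i)"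
  unfolding laurent_in_def using keys_sum[of F A] assms by (fastforce simp: laurent_in_def)

lemma laurent_in_of_nat_mult:
  assumes "laurent_in n P"
  shows "laurent_in n (of_nat m * P)"
  using laurent_in_sum[of "{..<m}" n "\<lambda>_. P"] assms by simp

lemma laurent_in_orbit_sum_one_column:
  assumes "k \<le> n"
  shows "laurent_in n (orbit_sum n (one_column k))"
  unfolding orbit_sum_one_column[OF assms]
  by (rule laurent_in_sum) (auto simp: laurent_in_def column_orbit_def)

text \<open>The size of the support is \<open>k\<close> throughout the orbit, so orbits of different
  columns are disjoint. This allows coordinates to be read off at the exponents of columns.\<close>

lemma lookup_orbit_sum_one_column:
  assumes "k \<le> n" "m \<le> n"
  shows "Poly_Mapping.lookup (orbit_sum n (one_column k)) (exponent n (one_column m)) = (if k = m then 1 else 0)"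
proof -
  have "exponent n (one_column m) \<in> column_orbit n k \<longleftrightarrow> k = m"
    using exponent_one_column_in_orbit[OF assms(2)]
    by (auto simp: column_orbit_def)
  then show ?thesis
    using assms finite_column_orbit[of n k]
    by (simp add: orbit_sum_one_column lookup_sum lookup_single when_def)
qed

section \<open>Orbit sums as elementary symmetric polynomials, and their generating function\<close>

definition var_sum :: "nat \<Rightarrow> laurent" where
  "var_sum i = monom_of (Poly_Mapping.single i 1) + monom_of (Poly_Mapping.single i (-1))"

lemma prod_monom_of: "(\<Prod>i\<in>A. monom_of (F i)) = (monom_of (\<Sum>i\<in>A. F i) :: laurent)"
  by (induction A rule: infinite_finite_induct) (simp_all add: mult_single)

lemma lookup_sum_single:
  assumes "finite A"
  shows "Poly_Mapping.lookup (\<Sum>i\<in>A. Poly_Mapping.single i (e i)) j = (if j \<in> A then e j else 0)"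
  using assms by (simp add: lookup_sum lookup_single when_def)

text \<open>Expanding the product amounts to choosing a sign of the exponent for each index in
  \<open>A\<close>, and each such choice is one exponent with support exactly
  \<open>A\<close>.\<close>

lemma prod_var_sum:
  assumes "finite A"
  shows "(\<Prod>i\<in>A. var_sum i)
       = (\<Sum>\<nu> | Poly_Mapping.keys \<nu> = A \<and> (\<forall>i\<in>A. Poly_Mapping.lookup \<nu> i \<in> {1, -1}). monom_of \<nu>)"
proof -
  let ?e = "\<lambda>e. \<Sum>i\<in>A. Poly_Mapping.single i (e i) :: nat \<Rightarrow>\<^sub>0 int"
  have "(\<Prod>i\<in>A. var_sum i) = (\<Prod>i\<in>A. \<Sum>s\<in>{1, -1}. monom_of (Poly_Mapping.single i s))"
    by (simp add: var_sum_def)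
  also have "\<dots> = (\<Sum>e\<in>PiE A (\<lambda>_. {1, -1}). monom_of (?e e))"
    using assms by (subst prod_sum_PiE) (auto simp: prod_monom_of)
  also have "\<dots> = (\<Sum>\<nu> | Poly_Mapping.keys \<nu> = A \<and> (\<forall>i\<in>A. Poly_Mapping.lookup \<nu> i \<in> {1, -1}). monom_of \<nu>)"
  \<comment> \<open>The restriction makes the inverse map land in \<open>PiE\<close>, whose members
    are \<open>undefined\<close> outside \<open>A\<close>.\<close>
  proof (rule sum.reindex_bij_witness[where j = ?e and i = "\<lambda>\<nu>. restrict (Poly_Mapping.lookup \<nu>) A"])
    fix e assume e: "e \<in> PiE A (\<lambda>_. {1, -1 :: int})"
    show "restrict (Poly_Mapping.lookup (?e e)) A = e"
      using e assms by (auto simp: fun_eq_iff lookup_sum_single restrict_def PiE_def extensional_def)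
    show "?e e \<in> {\<nu>. Poly_Mapping.keys \<nu> = A \<and> (\<forall>i\<in>A. Poly_Mapping.lookup \<nu> i \<in> {1, -1})}"
    proof -
      have "e i \<in> {1, -1}" "e i \<noteq> 0" if "i \<in> A" for i
        using PiE_mem[OF e that] by auto
      then show ?thesis
        using assms by (auto simp: in_keys_iff lookup_sum_single split: if_splits)
    qed
  next
    fix \<nu> :: "nat \<Rightarrow>\<^sub>0 int"
    assume \<nu>: "\<nu> \<in> {\<nu>. Poly_Mapping.keys \<nu> = A \<and> (\<forall>i\<in>A. Poly_Mapping.lookup \<nu> i \<in> {1, -1})}"
    show "?e (restrict (Poly_Mapping.lookup \<nu>) A) = \<nu>"
      using \<nu> assms by (intro poly_mapping_eqI) (auto simp: lookup_sum_single in_keys_iff)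
    show "restrict (Poly_Mapping.lookup \<nu>) A \<in> PiE A (\<lambda>_. {1, -1})"
      using \<nu> by auto
  qed simp
  finally show ?thesis .
qed

text \<open>The orbit is grouped by the support of its members. The right side is the elementary
  symmetric polynomial of degree \<open>k\<close> in the \<open>var_sum i\<close>.\<close>

lemma orbit_sum_eq_sum_prod:
  assumes "k \<le> n"
  shows "orbit_sum n (one_column k) = (\<Sum>A | A \<subseteq> {1..n} \<and> card A = k. \<Prod>i\<in>A. var_sum i)"
proof -
  have "(\<Sum>A | A \<subseteq> {1..n} \<and> card A = k. \<Prod>i\<in>A. var_sum i)
      = (\<Sum>A | A \<subseteq> {1..n} \<and> card A = k. \<Sum>\<nu> | \<nu> \<in> column_orbit n k \<and> Poly_Mapping.keys \<nu> = A. monom_of \<nu>)"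
  proof (intro sum.cong refl)
    fix A assume A: "A \<in> {A. A \<subseteq> {1..n} \<and> card A = k}"
    then have "finite A" using finite_subset by blast
    moreover have "{\<nu>. Poly_Mapping.keys \<nu> = A \<and> (\<forall>i\<in>A. Poly_Mapping.lookup \<nu> i \<in> {1, -1})}
        = {\<nu>. \<nu> \<in> column_orbit n k \<and> Poly_Mapping.keys \<nu> = A}"
      using A by (auto simp: column_orbit_def)
    ultimately show "(\<Prod>i\<in>A. var_sum i) = (\<Sum>\<nu> | \<nu> \<in> column_orbit n k \<and> Poly_Mapping.keys \<nu> = A. monom_of \<nu>)"
      by (simp add: prod_var_sum)
  qed
  also have "\<dots> = (\<Sum>\<nu>\<in>column_orbit n k. monom_of \<nu>)"
    by (rule sum.group[OF finite_column_orbit]) (auto simp: column_orbit_def)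
  finally show ?thesis using assms by (simp add: orbit_sum_one_column)
qed

text \<open>The binomial theorem in the square of the variable, by Pascal's rule.\<close>

lemma coeff_one_plus_square_power:
  "coeff ([:1, 0, 1:] ^ m :: 'a::comm_ring_1 poly) s = (if even s then of_nat (m choose (s div 2)) else 0)"
proof (induction m arbitrary: s)
  case 0
  then show ?case
    by (auto simp: coeff_pCons binomial_eq_0 split: nat.splits elim!: evenE)
next
  case (Suc m)
  show ?case
  proof (cases s)
    case (Suc s')
    then show ?thesis
      using Suc.IH by (cases s') (auto simp: coeff_pCons add.commute)
  qed (simp add: Suc.IH)
qed

text \<open>The form of the right side of the theorem; for \<open>r \<le> n\<close> it is the
  coefficient \<open>e_r\<close> of the generating function.\<close>

definition column_poly :: "nat \<Rightarrow> nat \<Rightarrow> laurent" where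
  "column_poly n r = (\<Sum>k=0..r div 2. of_nat ((n - r + 2 * k) choose k) * orbit_sum n (one_column (r - 2 * k)))"

text \<open>Each factor is split as \<open>X z + (1 + z^2)\<close>. Choosing the first part on a set
  \<open>A\<close> of size \<open>k\<close> leaves \<open>(1 + z^2) ^ (n - k)\<close>, whose
  coefficient at \<open>z ^ (r - k)\<close> is a binomial coefficient; summing over \<open>A\<close>
  gives an orbit sum.\<close>

lemma coeff_prod_var_sum:
  assumes "r \<le> n"
  shows "coeff (\<Prod>i=1..n. [:1, var_sum i, 1:]) r = column_poly n r"
proof -
  \<comment> \<open>The guard \<open>k \<le> r\<close> matters: for \<open>k > r\<close> the
    truncated difference \<open>r - k\<close> is \<open>0\<close>, hence even, and the binomial
    coefficient would be \<open>1\<close>.\<close>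
  define c :: "nat \<Rightarrow> laurent"
    where "c k = (if k \<le> r \<and> even (r - k) then of_nat ((n - k) choose ((r - k) div 2)) else 0)" for k
  let ?V = "\<lambda>A. \<Prod>i\<in>A. var_sum i"
  have V: "(\<Prod>i\<in>A. [:0, var_sum i:]) = monom (?V A) (card A)" for A
    by (induction A rule: infinite_finite_induct)
      (simp_all add: monom_0 monom_Suc smult_monom)
  have "(\<Prod>i=1..n. [:1, var_sum i, 1:]) = (\<Prod>i=1..n. [:0, var_sum i:] + [:1, 0, 1:])"
    by simp
  also have "\<dots> = (\<Sum>A\<in>Pow {1..n}. monom (?V A) (card A) * [:1, 0, 1:] ^ card ({1..n} - A))"
    unfolding prod_add[OF finite_atLeastAtMost] by (simp only: V prod_constant)
  finally have "coeff (\<Prod>i=1..n. [:1, var_sum i, 1:]) r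
      = (\<Sum>A\<in>Pow {1..n}. coeff (monom (?V A) (card A) * [:1, 0, 1:] ^ card ({1..n} - A)) r)"
    by (simp only: coeff_sum)
  also have "\<dots> = (\<Sum>A\<in>Pow {1..n}. c (card A) * ?V A)"
  proof (intro sum.cong refl)
    fix A assume "A \<in> Pow {1..n}"
    then have "card ({1..n} - A) = n - card A"
      by (simp add: card_Diff_subset finite_subset[OF _ finite_atLeastAtMost])
    then show "coeff (monom (?V A) (card A) * [:1, 0, 1:] ^ card ({1..n} - A)) r = c (card A) * ?V A"
      by (simp add: c_def coeff_monom_mult coeff_one_plus_square_power)
  qed
  also have "\<dots> = (\<Sum>k\<in>{0..n}. \<Sum>A | A \<in> Pow {1..n} \<and> card A = k. c (card A) * ?V A)"
    by (rule sum.group[symmetric]) (auto dest: card_mono[OF finite_atLeastAtMost])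
  also have "\<dots> = (\<Sum>k\<in>{0..n}. c k * orbit_sum n (one_column k))"
  proof (intro sum.cong refl)
    fix k assume "k \<in> {0..n}"
    then show "(\<Sum>A | A \<in> Pow {1..n} \<and> card A = k. c (card A) * ?V A) = c k * orbit_sum n (one_column k)"
      unfolding sum_distrib_left by (subst orbit_sum_eq_sum_prod) (auto simp: sum_distrib_left intro!: sum.cong)
  qed
  also have "\<dots> = (\<Sum>k\<in>{k. k \<le> r \<and> even (r - k)}. of_nat ((n - k) choose ((r - k) div 2)) * orbit_sum n (one_column k))"
    using assms by (intro sum.mono_neutral_cong_right) (auto simp: c_def)
  also have "\<dots> = column_poly n r"
    unfolding column_poly_def
    by (rule sum.reindex_bij_witness[where i = "\<lambda>k. r - 2 * k" and j = "\<lambda>k. (r - k) div 2"])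
      (use assms in auto)
  finally show ?thesis .
qed

lemma coeff_quadratic_mult:
  fixes p :: "'a::comm_ring_1 poly"
  shows "coeff ([:1, y, 1:] * p) r = coeff p r + (case r of 0 \<Rightarrow> 0 | Suc s \<Rightarrow> y * coeff p s +
      (case s of 0 \<Rightarrow> 0 | Suc t \<Rightarrow> coeff p t))"
  by (auto simp: coeff_pCons split: nat.splits)

text \<open>The coefficients are integer polynomials in the \<open>F i\<close>, so a ring
  homomorphism passes through them. It is applied to \<open>to_fract\<close>, alone and after a
  shift.\<close>

lemma coeff_prod_quadratic_hom:
  fixes h :: "'a::comm_ring_1 \<Rightarrow> 'b::comm_ring_1"
  assumes "h 0 = 0" "h 1 = 1" "\<And>a b. h (a + b) = h a + h b" "\<And>a b. h (a * b) = h a * h b"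
  shows "coeff (\<Prod>i\<in>A. [:1, h (F i), 1:]) r = h (coeff (\<Prod>i\<in>A. [:1, F i, 1:]) r)"
proof (induction A arbitrary: r rule: infinite_finite_induct)
  case (insert a A)
  show ?case
    unfolding prod.insert[OF insert(1,2)] coeff_quadratic_mult using insert(3) assms by (auto split: nat.splits)
qed (auto simp: assms)

section \<open>The operator at the special parameters\<close>

lemma to_fract_power: "to_fract (x ^ m) = to_fract x ^ m"
  by (induction m) simp_all

lemma ratfun_const_hom:
  "ratfun_const 0 = 0" "ratfun_const 1 = 1" "ratfun_const (c * d) = ratfun_const c * ratfun_const d"
  "ratfun_const (c + d) = ratfun_const c + ratfun_const d"
  "ratfun_const (c - d) = ratfun_const c - ratfun_const d" "ratfun_const (- c) = - ratfun_const c"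
  by (simp_all only: const_of_mult to_fract_mult single_add single_diff single_uminus single_zero
      single_one to_fract_add to_fract_diff to_fract_uminus to_fract_0 to_fract_1)

lemma ratfun_const_eq_0_iff: "ratfun_const c = 0 \<longleftrightarrow> c = 0"
  by (metis single_zero inj_single injD to_fract_eq_0_iff)

lemma ratfun_const_power: "ratfun_const (c ^ m) = ratfun_const c ^ m"
  by (induction m) (simp_all only: power_0 power_Suc ratfun_const_hom)

lemma ratfun_const_inverse: "ratfun_const (inverse c) = inverse (ratfun_const c)"
proof (cases "c = 0")
  case False
  have "ratfun_const c * ratfun_const (inverse c) = ratfun_const (c * inverse c)"
    by (simp only: ratfun_const_hom)
  also have "\<dots> = 1"
    using False by simp
  finally show ?thesis by (simp add: inverse_unique)
qed (simp only: inverse_zero ratfun_const_hom)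

lemma infinite_ratfun: "infinite (UNIV :: laurent fract set)"
proof -
  have "inj ratfun_const"
    by (rule injI) (metis inj_single injD to_fract_eq_iff)
  then show ?thesis
    using finite_imageD finite_subset infinite_UNIV_char_0 subset_UNIV by metis
qed

lemma ratfun_var_neq_0: "ratfun_var i \<noteq> 0"
  by (metis lookup_single_eq lookup_zero to_fract_eq_0_iff zero_neq_one)

lemma ratfun_var_inverse: "to_fract (monom_of (Poly_Mapping.single i (-1))) = 1 / ratfun_var i"
proof -
  have "ratfun_var i * to_fract (monom_of (Poly_Mapping.single i (-1))) = 1"
    by (simp add: to_fract_mult[symmetric] mult_single single_add[symmetric] del: to_fract_mult)
  then show ?thesis
    using ratfun_var_neq_0[of i] by (simp add: field_simps)
qed

lemma to_fract_var_sum: "to_fract (var_sum i) = ratfun_var i + 1 / ratfun_var i"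
  by (simp add: var_sum_def ratfun_var_inverse)

text \<open>The monomial \<open>x_i\<close> occurs in \<open>var_sum i\<close> but in no other
  \<open>var_sum j\<close>. This makes the interpolation nodes distinct.\<close>

lemma inj_var_sum: "inj var_sum"
proof (rule injI, rule ccontr)
  fix i j assume eq: "var_sum i = var_sum j" and "i \<noteq> j"
  have *: "Poly_Mapping.single j k \<noteq> Poly_Mapping.single i (1::int)" if "j \<noteq> i \<or> k \<noteq> 1" for j k
  proof
    assume "Poly_Mapping.single j k = Poly_Mapping.single i 1"
    then have "Poly_Mapping.lookup (Poly_Mapping.single j k) i = 1" by simp
    with that show False by (auto simp: lookup_single when_def split: if_splits)
  qed
  have "Poly_Mapping.lookup (var_sum i) (Poly_Mapping.single i 1) = 1"
    "Poly_Mapping.lookup (var_sum j) (Poly_Mapping.single i 1) = 0"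
    using \<open>i \<noteq> j\<close> by (simp_all add: var_sum_def lookup_add lookup_single_not_eq *)
  with eq show False by simp
qed

text \<open>A nonzero multiple of \<open>x_i^2\<close> is not constant. This keeps
  \<open>1 - y^2\<close> and \<open>1 - q y^2\<close> nonzero at \<open>y = x_i\<close> and at
  \<open>y = 1 / x_i\<close>.\<close>

lemma ratfun_const_mult_var_square_neq:
  assumes "c \<noteq> 0"
  shows "ratfun_const c * (ratfun_var i)\<^sup>2 \<noteq> ratfun_const d"
proof -
  have "const_of c * (monom_of (Poly_Mapping.single i 1))\<^sup>2 = Poly_Mapping.single (Poly_Mapping.single i 2) c"
    by (simp add: power2_eq_square mult_single single_add[symmetric])
  moreover have "Poly_Mapping.single (Poly_Mapping.single i (2::int)) c \<noteq> Poly_Mapping.single 0 d"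
  proof
    assume eq: "Poly_Mapping.single (Poly_Mapping.single i (2::int)) c = Poly_Mapping.single 0 d"
    have "Poly_Mapping.single i (2::int) \<noteq> 0"
      by (metis lookup_single_eq lookup_zero zero_neq_numeral)
    then show False
      using arg_cong[OF eq, of "\<lambda>P. Poly_Mapping.lookup P (Poly_Mapping.single i 2)"] assms
      by (simp add: lookup_single_not_eq)
  qed
  ultimately show ?thesis
    by (simp add: to_fract_mult[symmetric] to_fract_power[symmetric] del: to_fract_mult)
qed

text \<open>
  At these parameters \<open>(1 - ay)(1 - by)(1 - cy)(1 - dy)\<close> cancels against \<open>(1 - y\<^sup>2)(1 - qy\<^sup>2)\<close>.
\<close>

lemma koornwinder_coeff_factor:
  assumes q: "q \<noteq> 0" and s: "s * s = q" and i: "i \<in> {1..n}"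
    and y: "y \<noteq> 0" "y + 1 / y = to_fract (var_sum i)"
    and nz: "y\<^sup>2 \<noteq> 1" "ratfun_const q * y\<^sup>2 \<noteq> 1"
  shows "koornwinder_coeff n 1 1 (-1) s (- s) q q i y
       = (\<Prod>j\<in>{1..n} - {i}. (ratfun_const q * y + 1 / (ratfun_const q * y) - to_fract (var_sum j))
            / (to_fract (var_sum i) - to_fract (var_sum j)))"
proof -
  define Q where "Q = ratfun_const q"
  define S where "S = ratfun_const s"
  have Q: "Q \<noteq> 0" unfolding Q_def ratfun_const_eq_0_iff by (rule q)
  have SQ: "S * S = Q" unfolding S_def Q_def using s ratfun_const_hom(3) by metis
  \<comment> \<open>Numerator and denominator have the shape
    \<open>(1 - p * x) * (1 - p / x)\<close> with \<open>p = Q * y\<close> and \<open>p = y\<close>.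
    Their quotient leaves one factor \<open>Q\<close> for each \<open>j\<close>; these
    \<open>n - 1\<close> factors cancel against \<open>t ^ (n - 1)\<close>.\<close>
  have fac: "(1 - Q * y * ratfun_var j) * (1 - Q * y / ratfun_var j) / ((1 - y * ratfun_var j) * (1 - y / ratfun_var j))
      = Q * ((Q * y + 1 / (Q * y) - to_fract (var_sum j)) / (to_fract (var_sum i) - to_fract (var_sum j)))" for j
  proof -
    have "(1 - p * ratfun_var j) * (1 - p / ratfun_var j) = p * (p + 1 / p - to_fract (var_sum j))"
      if "p \<noteq> 0" for p
      unfolding to_fract_var_sum using that ratfun_var_neq_0[of j] by (simp add: field_simps)
    from this[of "Q * y"] this[of y] show ?thesis
      using Q y by simp
  qed
  have "(\<Prod>j\<in>{1..n} - {i}. (1 - Q * y * ratfun_var j) * (1 - Q * y / ratfun_var j) / ((1 - y * ratfun_var j) * (1 - y / ratfun_var j)))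
      = Q ^ (n - 1) * (\<Prod>j\<in>{1..n} - {i}. (Q * y + 1 / (Q * y) - to_fract (var_sum j)) / (to_fract (var_sum i) - to_fract (var_sum j)))"
    unfolding fac prod.distrib using i by simp
  moreover have "(1 - ratfun_const 1 * y) * (1 - ratfun_const (- 1) * y) * (1 - S * y) * (1 - ratfun_const (- s) * y)
      = (1 - y\<^sup>2) * (1 - Q * y\<^sup>2)"
    unfolding ratfun_const_hom(2,6) S_def[symmetric] SQ[symmetric]
    by (simp add: power2_eq_square algebra_simps)
  moreover have "ratfun_const (1 * q ^ (n - 1)) = Q ^ (n - 1)"
    by (simp only: mult_1_left ratfun_const_power Q_def)
  ultimately show ?thesis
    unfolding koornwinder_coeff_def Q_def[symmetric] S_def[symmetric]
    using nz Q by (simp only: Q_def[symmetric]) simp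
qed

text \<open>The shift is a ring homomorphism fixing \<open>var_sum j\<close> for
  \<open>j \<noteq> i\<close>, so it changes only one factor of the generating function.\<close>

lemma to_fract_shift_column_poly:
  assumes "p \<noteq> 0" "r \<le> n" "i \<in> {1..n}"
  shows "to_fract (shift p i (column_poly n r))
       = coeff ([:1, ratfun_const p * ratfun_var i + 1 / (ratfun_const p * ratfun_var i), 1:]
           * (\<Prod>j\<in>{1..n} - {i}. [:1, to_fract (var_sum j), 1:])) r"
proof -
  define h where "h = (\<lambda>P. to_fract (shift p i P))"
  have "to_fract (shift p i (column_poly n r)) = coeff (\<Prod>j=1..n. [:1, h (var_sum j), 1:]) r"
    unfolding coeff_prod_var_sum[OF assms(2), symmetric] h_def using assms(1)
    by (subst coeff_prod_quadratic_hom) (simp_all add: shift_0 shift_1 shift_add shift_mult)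
  also have "(\<Prod>j=1..n. [:1, h (var_sum j), 1:])
      = [:1, h (var_sum i), 1:] * (\<Prod>j\<in>{1..n} - {i}. [:1, h (var_sum j), 1:])"
    using assms(3) by (simp add: prod.remove)
  also have "h (var_sum j) = to_fract (var_sum j)" if "j \<noteq> i" for j
    using that by (simp add: h_def var_sum_def shift_add shift_single lookup_single_not_eq)
  then have "(\<Prod>j\<in>{1..n} - {i}. [:1, h (var_sum j), 1:]) = (\<Prod>j\<in>{1..n} - {i}. [:1, to_fract (var_sum j), 1:])"
    by (intro prod.cong) auto
  also have "h (var_sum i) = ratfun_const p * ratfun_var i + 1 / (ratfun_const p * ratfun_var i)"
  proof -
    have 1: "shift p i (monom_of (Poly_Mapping.single i k)) = const_of (p powi k) * monom_of (Poly_Mapping.single i k)" for k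
      by (simp add: shift_single mult_single)
    have "h (var_sum i) = ratfun_const p * ratfun_var i + ratfun_const (inverse p) * (1 / ratfun_var i)"
      unfolding h_def var_sum_def shift_add 1 to_fract_add to_fract_mult ratfun_var_inverse
      by (simp add: power_int_minus)
    then show ?thesis
      by (simp add: ratfun_const_inverse divide_inverse)
  qed
  finally show ?thesis .
qed

text \<open>This is the coefficient of \<open>z^r\<close> in
  \<open>generating_function_eigen\<close>, taken over the rational functions: rescaling
  \<open>z\<close> by \<open>q\<close> or \<open>1 / q\<close> multiplies it by \<open>q^r\<close>
  or \<open>1 / q^r\<close>.\<close>

lemma koornwinder_operator_column_poly:
  assumes q: "q \<noteq> 0" and s: "s * s = q" and r: "r \<le> n"
  shows "koornwinder_operator n 1 1 (-1) s (- s) q q (column_poly n r)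
       = ratfun_const (q ^ n + 1 / q ^ n - q ^ (n - r) - 1 / q ^ (n - r)) * to_fract (column_poly n r)"
proof -
  define Q where "Q = ratfun_const q"
  have Q: "Q \<noteq> 0" unfolding Q_def ratfun_const_eq_0_iff by (rule q)
  define x where "x i = ratfun_var i" for i
  have x: "x i \<noteq> 0" for i unfolding x_def by (rule ratfun_var_neq_0)
  define X where "X i = to_fract (var_sum i)" for i
  have X: "X i = x i + 1 / x i" for i
    by (simp add: X_def x_def to_fract_var_sum)
  have inj: "inj_on X {1..n}"
    using inj_var_sum by (auto simp: X_def inj_on_def)
  define Yp where "Yp i = Q * x i + 1 / (Q * x i)" for i
  define Ym where "Ym i = x i / Q + Q / x i" for i
  define E where "E = (\<Prod>i=1..n. [:1, X i, 1:])"
  have E: "coeff E r = to_fract (column_poly n r)"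
    unfolding coeff_prod_var_sum[OF r, symmetric] E_def X_def
    by (rule coeff_prod_quadratic_hom) simp_all
  have sq: "(x i)\<^sup>2 \<noteq> 1" "Q * (x i)\<^sup>2 \<noteq> 1" "(x i)\<^sup>2 \<noteq> Q" for i
    using ratfun_const_mult_var_square_neq[of 1 i 1] ratfun_const_mult_var_square_neq[of q i 1]
      ratfun_const_mult_var_square_neq[of 1 i q] q
    unfolding x_def Q_def ratfun_const_hom(2) by simp_all
  have cp: "koornwinder_coeff n 1 1 (-1) s (- s) q q i (x i) = (\<Prod>j\<in>{1..n} - {i}. (Yp i - X j) / (X i - X j))"
    if "i \<in> {1..n}" for i
    using koornwinder_coeff_factor[OF q s that, of "x i"] x sq X[of i]
    unfolding Q_def[symmetric] X_def[symmetric] Yp_def by simp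
  \<comment> \<open>Inverting \<open>x i\<close> preserves \<open>X i\<close> and exchanges
    \<open>Yp i\<close> with \<open>Ym i\<close>.\<close>
  have cm: "koornwinder_coeff n 1 1 (-1) s (- s) q q i (1 / x i) = (\<Prod>j\<in>{1..n} - {i}. (Ym i - X j) / (X i - X j))"
    if "i \<in> {1..n}" for i
  proof -
    have "1 / x i \<noteq> 0" "1 / x i + 1 / (1 / x i) = X i" "(1 / x i)\<^sup>2 \<noteq> 1" "Q * (1 / x i)\<^sup>2 \<noteq> 1"
      using x[of i] sq(1,3)[of i] by (auto simp: X power_divide)
    moreover have "Q * (1 / x i) + 1 / (Q * (1 / x i)) = Ym i"
      by (simp add: Ym_def)
    ultimately show ?thesis
      using koornwinder_coeff_factor[OF q s that, of "1 / x i"]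
      unfolding Q_def[symmetric] X_def[symmetric] by (simp only: simp_thms)
  qed
  have sp: "to_fract (shift q i (column_poly n r)) = coeff ([:1, Yp i, 1:] * (\<Prod>j\<in>{1..n} - {i}. [:1, X j, 1:])) r"
    if "i \<in> {1..n}" for i
    using to_fract_shift_column_poly[OF q r that] by (simp only: Yp_def X_def x_def Q_def)
  have sm: "to_fract (shift (inverse q) i (column_poly n r)) = coeff ([:1, Ym i, 1:] * (\<Prod>j\<in>{1..n} - {i}. [:1, X j, 1:])) r"
    if "i \<in> {1..n}" for i
  proof -
    have "ratfun_const (inverse q) * ratfun_var i + 1 / (ratfun_const (inverse q) * ratfun_var i) = Ym i"
      unfolding ratfun_const_inverse Ym_def x_def Q_def by (simp add: field_simps)
    then show ?thesis
      using to_fract_shift_column_poly[of "inverse q", OF _ r that] q by (simp only: X_def) simp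
  qed
  have "koornwinder_operator n 1 1 (-1) s (- s) q q (column_poly n r)
      = (\<Sum>i=1..n. (\<Prod>j\<in>{1..n} - {i}. (Yp i - X j) / (X i - X j)) *
           coeff ([:1, Yp i, 1:] * (\<Prod>j\<in>{1..n} - {i}. [:1, X j, 1:]) - E) r)
      + (\<Sum>i=1..n. (\<Prod>j\<in>{1..n} - {i}. (Ym i - X j) / (X i - X j)) *
           coeff ([:1, Ym i, 1:] * (\<Prod>j\<in>{1..n} - {i}. [:1, X j, 1:]) - E) r)"
    unfolding koornwinder_operator_def x_def[symmetric]
    by (intro arg_cong2[of _ _ _ _ "(+)"] sum.cong refl) (simp_all only: cp cm sp sm E coeff_diff)
  also have "\<dots> = coeff (smult (Q ^ n + 1 / Q ^ n) E
       - (smult (1 / Q ^ n) (pcompose E [:0, Q:]) + smult (Q ^ n) (pcompose E [:0, 1 / Q:]))) r"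
    using generating_function_eigen[OF infinite_ratfun Q finite_atLeastAtMost x X inj Yp_def Ym_def, folded E_def]
    by (simp only: card_atLeastAtMost diff_Suc_1 coeff_sum[symmetric] coeff_smult[symmetric] coeff_add[symmetric])
  also have "\<dots> = (Q ^ n + 1 / Q ^ n - Q ^ (n - r) - 1 / Q ^ (n - r)) * coeff E r"
  proof -
    have "Q ^ n = Q ^ (n - r) * Q ^ r"
      using r by (simp add: power_add[symmetric])
    then show ?thesis
      using Q by (simp add: coeff_pcompose_linear power_divide field_simps)
  qed
  also have "Q ^ n + 1 / Q ^ n - Q ^ (n - r) - 1 / Q ^ (n - r)
      = ratfun_const (q ^ n + 1 / q ^ n - q ^ (n - r) - 1 / q ^ (n - r))"
    unfolding divide_inverse mult_1_left ratfun_const_hom ratfun_const_inverse ratfun_const_power Q_def ..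
  finally show ?thesis unfolding E .
qed

section \<open>Linearity of the operator\<close>

lemma koornwinder_operator_add:
  "koornwinder_operator n \<alpha> a b c d q t (P + R)
   = koornwinder_operator n \<alpha> a b c d q t P + koornwinder_operator n \<alpha> a b c d q t R"
  by (simp add: koornwinder_operator_def shift_add sum.distrib sum_subtractf algebra_simps)

lemma koornwinder_operator_const_mult:
  "koornwinder_operator n \<alpha> a b c d q t (const_of k * P) = ratfun_const k * koornwinder_operator n \<alpha> a b c d q t P"
  by (simp only: koornwinder_operator_def shift_const_mult to_fract_mult sum_distrib_left
      distrib_left right_diff_distrib mult.left_commute)

lemma koornwinder_operator_sum:
  "koornwinder_operator n \<alpha> a b c d q t (\<Sum>i\<in>A. F i) = (\<Sum>i\<in>A. koornwinder_operator n \<alpha> a b c d q t (F i))"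
proof -
  have "koornwinder_operator n \<alpha> a b c d q t 0 = 0"
    by (simp add: koornwinder_operator_def shift_0)
  then show ?thesis
    by (induction A rule: infinite_finite_induct) (simp_all add: koornwinder_operator_add)
qed

section \<open>Partitions below a column and the unitriangular change of basis\<close>

lemma sum_one_column: "k \<le> n \<Longrightarrow> (\<Sum>j=1..n. one_column k j) = k"
  unfolding one_column_def by (subst sum.inter_restrict[symmetric]) (simp_all add: Int_absorb1)

lemma inj_one_column: "inj one_column"
proof (rule injI)
  fix k m assume eq: "one_column k = one_column m"
  show "k = m"
    using sum_one_column[of k "max k m"] sum_one_column[of m "max k m"] unfolding eq by simp
qed

text \<open>The first partial sum bounds every part by \<open>1\<close>, so \<open>\<mu>\<close> is
  a column, and the last partial sum bounds its length. All shorter columns occur, whatever their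
  parity, because dominance does not fix the size.\<close>

lemma partitions_below_one_column:
  assumes n: "n \<ge> 1" and r: "r \<le> n"
  shows "{\<mu>. is_partition n \<mu> \<and> dominance_less n \<mu> (one_column r)} = one_column ` {..<r}"
proof (intro equalityI subsetI)
  fix \<mu> assume "\<mu> \<in> {\<mu>. is_partition n \<mu> \<and> dominance_less n \<mu> (one_column r)}"
  then have out: "\<And>i. i \<notin> {1..n} \<Longrightarrow> \<mu> i = 0"
    and mono: "\<And>i j. i \<in> {1..n} \<Longrightarrow> j \<in> {1..n} \<Longrightarrow> i \<le> j \<Longrightarrow> \<mu> j \<le> \<mu> i"
    and neq: "\<mu> \<noteq> one_column r"
    and dom: "\<And>i. i \<in> {1..n} \<Longrightarrow> (\<Sum>j=1..i. \<mu> j) \<le> (\<Sum>j=1..i. one_column r j)"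
    unfolding is_partition_def dominance_less_def by blast+
  have le1: "\<mu> j \<le> 1" for j
  proof (cases "j \<in> {1..n}")
    case True
    have "\<mu> 1 \<le> 1"
      using dom[of 1] n by (simp add: one_column_def split: if_splits)
    then show ?thesis
      using mono[of 1 j] n True by simp
  qed (simp add: out)
  \<comment> \<open>The number of nonzero parts; it is at most \<open>n\<close> since
    \<open>\<mu>\<close> vanishes at \<open>Suc n\<close>.\<close>
  define k where "k = (LEAST j. \<mu> (Suc j) = 0)"
  have k0: "\<mu> (Suc k) = 0"
    unfolding k_def by (rule LeastI[of _ n]) (simp add: out)
  have kn: "k \<le> n"
    unfolding k_def by (rule Least_le) (simp add: out)
  have k1: "\<mu> (Suc j) \<noteq> 0" if "j < k" for j
    using not_less_Least[of j] that unfolding k_def by blast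
  have \<mu>: "\<mu> = one_column k"
  proof
    fix j
    consider "j = 0" | "j \<in> {1..k}" | "j \<in> {Suc k..n}" | "j > n" by fastforce
    then show "\<mu> j = one_column k j"
    proof cases
      case 2
      then obtain i where "j = Suc i" "i < k" by (cases j) auto
      then show ?thesis
        using k1[of i] le1[of j] by (simp add: one_column_def)
    next
      case 3
      then show ?thesis
        using mono[of "Suc k" j] k0 by (simp add: one_column_def)
    qed (use kn in \<open>auto simp: out one_column_def\<close>)
  qed
  have "k \<le> r"
    using dom[of n] n kn r by (simp add: \<mu> sum_one_column del: One_nat_def)
  moreover have "k \<noteq> r" using neq \<mu> by blast
  ultimately show "\<mu> \<in> one_column ` {..<r}"
    using \<mu> by auto
next
  fix \<mu> assume "\<mu> \<in> one_column ` {..<r}"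
  then obtain k where k: "k < r" "\<mu> = one_column k" by auto
  have "is_partition n \<mu>"
    using k r by (auto simp: is_partition_def one_column_def)
  moreover have "\<mu> \<noteq> one_column r"
    using k inj_one_column by (auto simp: inj_eq)
  moreover have "(\<Sum>j=1..i. \<mu> j) \<le> (\<Sum>j=1..i. one_column r j)" for i
    unfolding k(2) by (rule sum_mono) (use k(1) in \<open>auto simp: one_column_def\<close>)
  ultimately show "\<mu> \<in> {\<mu>. is_partition n \<mu> \<and> dominance_less n \<mu> (one_column r)}"
    by (simp add: dominance_less_def)
qed

text \<open>Injectivity of \<open>one_column\<close> lets coefficients indexed by partitions be
  indexed by column lengths instead.\<close>

lemma one_column_expansion_iff:
  assumes "n \<ge> 1" "r \<le> n"
  shows "(\<exists>u :: (nat \<Rightarrow> nat) \<Rightarrow> complex. P = orbit_sum n (one_column r) +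
            (\<Sum>\<mu> \<in> {\<mu>. is_partition n \<mu> \<and> dominance_less n \<mu> (one_column r)}.
               const_of (u \<mu>) * orbit_sum n \<mu>))
     \<longleftrightarrow> (\<exists>w :: nat \<Rightarrow> complex. P = orbit_sum n (one_column r) +
            (\<Sum>k<r. const_of (w k) * orbit_sum n (one_column k)))"
proof -
  have inj: "inj_on one_column {..<r}"
    using inj_one_column inj_on_subset by blast
  show ?thesis
    unfolding partitions_below_one_column[OF assms] sum.reindex[OF inj] o_def
  proof (intro iffI; elim exE)
    fix w :: "nat \<Rightarrow> complex"
    assume "P = orbit_sum n (one_column r) + (\<Sum>k<r. const_of (w k) * orbit_sum n (one_column k))"
    then show "\<exists>u :: (nat \<Rightarrow> nat) \<Rightarrow> complex. P = orbit_sum n (one_column r) +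
        (\<Sum>k<r. const_of (u (one_column k)) * orbit_sum n (one_column k))"
      by (intro exI[of _ "\<lambda>\<mu>. w (the_inv one_column \<mu>)"]) (simp add: the_inv_f_f[OF inj_one_column])
  next
    fix u :: "(nat \<Rightarrow> nat) \<Rightarrow> complex"
    assume "P = orbit_sum n (one_column r) + (\<Sum>k<r. const_of (u (one_column k)) * orbit_sum n (one_column k))"
    then show "\<exists>w. P = orbit_sum n (one_column r) + (\<Sum>k<r. const_of (w k) * orbit_sum n (one_column k))"
      by (rule exI[of _ "\<lambda>k. u (one_column k)"])
  qed
qed

lemma column_poly_expansion:
  obtains c where "column_poly n r = orbit_sum n (one_column r) +
    (\<Sum>k<r. const_of (c k) * orbit_sum n (one_column k))"
proof
  \<comment> \<open>The upper index \<open>n - r + (r - k)\<close> matches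
    \<open>column_poly\<close> also for \<open>r > n\<close>, where the truncated difference
    \<open>n - k\<close> would not. At \<open>k = r\<close> the coefficient is
    \<open>1\<close>.\<close>
  define c :: "nat \<Rightarrow> complex"
    where "c k = (if even (r - k) then of_nat ((n - r + (r - k)) choose ((r - k) div 2)) else 0)" for k
  have "column_poly n r = (\<Sum>k\<in>{k. k \<le> r \<and> even (r - k)}. const_of (c k) * orbit_sum n (one_column k))"
    unfolding column_poly_def
    by (rule sum.reindex_bij_witness[where j = "\<lambda>k. r - 2 * k" and i = "\<lambda>k. (r - k) div 2"])
      (auto simp: c_def)
  also have "\<dots> = (\<Sum>k\<le>r. const_of (c k) * orbit_sum n (one_column k))"
    by (intro sum.mono_neutral_left) (auto simp: c_def)
  also have "\<dots> = (\<Sum>k<Suc r. const_of (c k) * orbit_sum n (one_column k))"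
    by (simp only: lessThan_Suc_atMost)
  finally show "column_poly n r = orbit_sum n (one_column r) +
    (\<Sum>k<r. const_of (c k) * orbit_sum n (one_column k))"
    by (simp add: c_def add.commute)
qed

text \<open>A unitriangular system is inverted from the top: the last orbit sum is replaced by its
  column polynomial, and the lower terms this introduces are absorbed into the remaining
  coefficients.\<close>

lemma orbit_sums_in_column_polys:
  "\<exists>v. (\<Sum>k<N. const_of (w k) * orbit_sum n (one_column k)) = (\<Sum>k<N. const_of (v k) * column_poly n k)"
proof (induction N arbitrary: w)
  case (Suc N)
  obtain c where c: "column_poly n N = orbit_sum n (one_column N) +
      (\<Sum>k<N. const_of (c k) * orbit_sum n (one_column k))"
    by (rule column_poly_expansion)
  obtain v where v: "(\<Sum>k<N. const_of (w k - w N * c k) * orbit_sum n (one_column k))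
      = (\<Sum>k<N. const_of (v k) * column_poly n k)"
    using Suc.IH[of "\<lambda>k. w k - w N * c k"] by blast
  have "const_of (w N) * orbit_sum n (one_column N)
      = const_of (w N) * column_poly n N - (\<Sum>k<N. const_of (w N * c k) * orbit_sum n (one_column k))"
    by (simp only: c const_of_mult) (simp add: algebra_simps sum_distrib_left)
  then have "(\<Sum>k<Suc N. const_of (w k) * orbit_sum n (one_column k))
      = (\<Sum>k<N. const_of (w k - w N * c k) * orbit_sum n (one_column k)) + const_of (w N) * column_poly n N"
    by (simp add: single_diff left_diff_distrib sum_subtractf)
  also have "\<dots> = (\<Sum>k<Suc N. const_of ((v(N := w N)) k) * column_poly n k)"
    unfolding v by simp
  finally show ?case by (rule exI[of _ "v(N := w N)"])
qed simp

lemma lookup_column_poly: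
  assumes "k \<le> m" "m \<le> n"
  shows "Poly_Mapping.lookup (column_poly n k) (exponent n (one_column m)) = (if k = m then 1 else 0)"
proof -
  obtain c where c: "column_poly n k = orbit_sum n (one_column k) +
      (\<Sum>j<k. const_of (c j) * orbit_sum n (one_column j))"
    by (rule column_poly_expansion)
  show ?thesis
    unfolding c lookup_add lookup_sum lookup_const_mult
    using assms by (simp add: lookup_orbit_sum_one_column)
qed

text \<open>The leading monomial of the last column polynomial occurs in no earlier one, so its
  coefficient vanishes and the sum shortens. The bound on \<open>N\<close> ensures that every column
  fits into \<open>n\<close> variables.\<close>

lemma column_polys_independent:
  assumes "(\<Sum>k<N. const_of (c k) * column_poly n k) = 0" "N \<le> Suc n" "k < N"
  shows "c k = 0"
  using assms
proof (induction N)
  case (Suc N)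
  have "0 = Poly_Mapping.lookup (\<Sum>k<Suc N. const_of (c k) * column_poly n k) (exponent n (one_column N))"
    unfolding Suc.prems(1) by simp
  also have "\<dots> = c N"
    unfolding lookup_sum lookup_const_mult using Suc.prems(2) by (simp add: lookup_column_poly)
  finally have "c N = 0" by simp
  with Suc show ?case by (cases "k = N") auto
qed simp

section \<open>Eigenvalues of columns and their separation\<close>

lemma koornwinder_eigenvalue_one_column:
  assumes "q \<noteq> 0" "r \<le> n"
  shows "koornwinder_eigenvalue n 1 q q (one_column r) = q ^ n + 1 / q ^ n - q ^ (n - r) - 1 / q ^ (n - r)"
proof -
  define h where "h m = q ^ m + inverse (q ^ m)" for m
  \<comment> \<open>Terms with \<open>j > r\<close> vanish, and for \<open>j \<le> r\<close> the
    equality of \<open>t\<close> and \<open>q\<close> raises the exponent \<open>n - j\<close> by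
    one, so the sum telescopes.\<close>
  have "koornwinder_eigenvalue n 1 q q (one_column r) = (\<Sum>j=1..n. if j \<in> {1..r} then h (Suc n - j) - h (n - j) else 0)"
    unfolding koornwinder_eigenvalue_def
    by (intro sum.cong) (auto simp: one_column_def h_def Suc_diff_le mult.commute)
  also have "\<dots> = (\<Sum>j=1..r. h (Suc n - j) - h (n - j))"
    using assms(2) by (intro sum.mono_neutral_cong_right) auto
  also have "\<dots> = h n - h (n - r)"
    using assms(2)
  proof (induction r)
    case (Suc r)
    then show ?case by simp
  qed simp
  finally show ?thesis by (simp add: h_def divide_inverse)
qed

lemma power_neq_one:
  fixes q :: complex
  assumes "norm q < 1" "m > 0"
  shows "q ^ m \<noteq> 1"
  using power_less_one_iff[of "norm q" m] assms by (metis norm_ge_zero norm_one norm_power less_irrefl)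

text \<open>The difference of the two sides is, up to a nonzero factor,
  \<open>(q ^ b - q ^ a) * (q ^ (a + b) - 1)\<close>, and neither factor vanishes because
  \<open>q\<close> is nonzero of modulus below \<open>1\<close>.\<close>

lemma power_plus_inverse_inj:
  fixes q :: complex
  assumes q: "q \<noteq> 0" "norm q < 1" and ab: "a < b"
  shows "q ^ a + 1 / q ^ a \<noteq> q ^ b + 1 / q ^ b"
proof
  note neq1 = power_neq_one[OF q(2)]
  assume eq: "q ^ a + 1 / q ^ a = q ^ b + 1 / q ^ b"
  have "(q ^ b - q ^ a) * (q ^ a * q ^ b - 1) = q ^ a * q ^ b * ((q ^ b + 1 / q ^ b) - (q ^ a + 1 / q ^ a))"
    using q(1) by (simp add: field_simps)
  then have "q ^ b = q ^ a \<or> q ^ (a + b) = 1"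
    unfolding eq by (simp add: power_add)
  moreover have "q ^ b = q ^ a * q ^ (b - a)"
    using ab by (simp add: power_add[symmetric])
  ultimately show False
    using neq1[of "b - a"] neq1[of "a + b"] ab q(1) by auto
qed

text \<open>The column polynomial is an eigenvector of the required shape. Any other candidate
  differs from it by shorter column polynomials, whose eigenvalues are different, so independence
  removes them. The equivalence gives existence and uniqueness together.\<close>

lemma is_koornwinder_iff_column_poly:
  assumes n: "n \<ge> 1" and r: "r \<le> n" and q: "q \<noteq> 0" "norm q < 1"
  shows "is_koornwinder n 1 (-1) (csqrt q) (- csqrt q) q q (one_column r) P \<longleftrightarrow> P = column_poly n r"
proof -
  let ?s = "csqrt q"
  let ?D = "koornwinder_operator n 1 1 (-1) ?s (- ?s) q q"
  define d where "d k = q ^ n + 1 / q ^ n - q ^ (n - k) - 1 / q ^ (n - k)" for k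
  have s: "?s * ?s = q"
    using power2_csqrt[of q] by (simp add: power2_eq_square)
  \<comment> \<open>The product of the four parameters is \<open>q\<close>, so the radicand is
    \<open>1\<close>.\<close>
  have \<alpha>: "csqrt (1 * (-1) * ?s * (- ?s) / q) = 1"
    using s q by simp
  have eig: "?D (column_poly n k) = ratfun_const (d k) * to_fract (column_poly n k)" if "k \<le> n" for k
    unfolding d_def by (rule koornwinder_operator_column_poly[OF q(1) s that])
  have kw: "is_koornwinder n 1 (-1) ?s (- ?s) q q (one_column r) P \<longleftrightarrow> laurent_in n P \<and> W_invariant n P \<and>
      (\<exists>w. P = orbit_sum n (one_column r) + (\<Sum>k<r. const_of (w k) * orbit_sum n (one_column k))) \<and>
      ?D P = ratfun_const (d r) * to_fract P" for P
    unfolding is_koornwinder_def \<alpha> Let_def one_column_expansion_iff[OF n r]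
      koornwinder_eigenvalue_one_column[OF q(1) r] to_fract_mult d_def ..
  show ?thesis
  proof
    assume "P = column_poly n r"
    moreover have "laurent_in n (column_poly n r)" "W_invariant n (column_poly n r)"
      unfolding column_poly_def using r
      by (intro laurent_in_sum laurent_in_of_nat_mult laurent_in_orbit_sum_one_column
          W_invariant_sum W_invariant_of_nat_mult W_invariant_orbit_sum_one_column; simp)+
    moreover obtain c where "column_poly n r = orbit_sum n (one_column r) +
        (\<Sum>k<r. const_of (c k) * orbit_sum n (one_column k))"
      by (rule column_poly_expansion)
    ultimately show "is_koornwinder n 1 (-1) ?s (- ?s) q q (one_column r) P"
      unfolding kw using eig[OF r] by blast
  next
    assume "is_koornwinder n 1 (-1) ?s (- ?s) q q (one_column r) P"
    then obtain w where w: "P = orbit_sum n (one_column r) + (\<Sum>k<r. const_of (w k) * orbit_sum n (one_column k))"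
      and DP: "?D P = ratfun_const (d r) * to_fract P"
      unfolding kw by blast
    obtain c where c: "column_poly n r = orbit_sum n (one_column r) +
        (\<Sum>k<r. const_of (c k) * orbit_sum n (one_column k))"
      by (rule column_poly_expansion)
    \<comment> \<open>The leading orbit sums of \<open>P\<close> and \<open>column_poly n r\<close>
      cancel; the difference is rewritten in the eigenvectors.\<close>
    obtain v where v: "(\<Sum>k<r. const_of (w k - c k) * orbit_sum n (one_column k))
        = (\<Sum>k<r. const_of (v k) * column_poly n k)"
      using orbit_sums_in_column_polys[of "\<lambda>k. w k - c k"] by blast
    have P: "P = column_poly n r + (\<Sum>k<r. const_of (v k) * column_poly n k)"
      unfolding v[symmetric] w c by (simp add: single_diff left_diff_distrib sum_subtractf)
    have "?D P = ratfun_const (d r) * to_fract (column_poly n r)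
        + (\<Sum>k<r. ratfun_const (v k) * (ratfun_const (d k) * to_fract (column_poly n k)))"
      unfolding P koornwinder_operator_add koornwinder_operator_sum koornwinder_operator_const_mult eig[OF r]
      by (intro arg_cong2[of _ _ _ _ "(+)"] sum.cong refl) (use r in \<open>simp add: eig\<close>)
    moreover have "ratfun_const (d r) * to_fract P = ratfun_const (d r) * to_fract (column_poly n r)
        + (\<Sum>k<r. ratfun_const (v k) * (ratfun_const (d r) * to_fract (column_poly n k)))"
      unfolding P by (simp add: distrib_left sum_distrib_left mult.left_commute)
    \<comment> \<open>Comparing the two expressions for the image of \<open>P\<close> leaves each
      coefficient multiplied by a difference of eigenvalues.\<close>
    ultimately have "to_fract (\<Sum>k<r. const_of (v k * (d k - d r)) * column_poly n k) = 0"
      using DP unfolding to_fract_sum to_fract_mult ratfun_const_hom(3,5)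
      by (simp only: right_diff_distrib left_diff_distrib sum_subtractf mult.assoc) simp
    then have 0: "(\<Sum>k<r. const_of (v k * (d k - d r)) * column_poly n k) = 0"
      by (simp only: to_fract_eq_0_iff)
    have "v k = 0" if "k < r" for k
    proof -
      have "v k * (d k - d r) = 0"
        using column_polys_independent[OF 0 _ that] r by simp
      moreover have "q ^ (n - r) + 1 / q ^ (n - r) \<noteq> q ^ (n - k) + 1 / q ^ (n - k)"
        using that r by (intro power_plus_inverse_inj q) simp
      then have "d k - d r \<noteq> 0"
        by (simp add: d_def algebra_simps)
      ultimately show ?thesis by simp
    qed
    then show "P = column_poly n r"
      unfolding P by simp
  qed
qed

section \<open>The function \<open>f\<close> and its specializations\<close>

lemma column_f_cleared:
  fixes a c t s :: "'k::field"
  assumes "a \<noteq> 0" "c \<noteq> 0" "s \<noteq> 0"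
  shows "column_f a c t s = ((s - 1) * (s * a\<^sup>2 * c\<^sup>2 - t\<^sup>2) * (s * a\<^sup>2 + t) * (s * c\<^sup>2 + t)) /
    ((s\<^sup>2 * a\<^sup>2 * c\<^sup>2 - t) * (s\<^sup>2 * a\<^sup>2 * c\<^sup>2 - t ^ 3))"
proof -
  have "1 - 1 / s = (s - 1) / s"
    "1 - t\<^sup>2 / (s * a\<^sup>2 * c\<^sup>2) = (s * a\<^sup>2 * c\<^sup>2 - t\<^sup>2) / (s * a\<^sup>2 * c\<^sup>2)"
    "1 + t / (s * a\<^sup>2) = (s * a\<^sup>2 + t) / (s * a\<^sup>2)"
    "1 + t / (s * c\<^sup>2) = (s * c\<^sup>2 + t) / (s * c\<^sup>2)"
    "1 - t / (s\<^sup>2 * a\<^sup>2 * c\<^sup>2) = (s\<^sup>2 * a\<^sup>2 * c\<^sup>2 - t) / (s\<^sup>2 * a\<^sup>2 * c\<^sup>2)"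
    "1 - t ^ 3 / (s\<^sup>2 * a\<^sup>2 * c\<^sup>2) = (s\<^sup>2 * a\<^sup>2 * c\<^sup>2 - t ^ 3) / (s\<^sup>2 * a\<^sup>2 * c\<^sup>2)"
    using assms by (simp_all add: diff_divide_distrib add_divide_distrib)
  \<comment> \<open>Numerator and denominator are cleared by the same factor
    \<open>(s\<^sup>2 * a\<^sup>2 * c\<^sup>2)\<^sup>2\<close>, so it drops out even where the
    denominator vanishes.\<close>
  then have "column_f a c t s = ((s - 1) * (s * a\<^sup>2 * c\<^sup>2 - t\<^sup>2) * (s * a\<^sup>2 + t) * (s * c\<^sup>2 + t) / (s\<^sup>2 * a\<^sup>2 * c\<^sup>2)\<^sup>2) /
    ((s\<^sup>2 * a\<^sup>2 * c\<^sup>2 - t) * (s\<^sup>2 * a\<^sup>2 * c\<^sup>2 - t ^ 3) / (s\<^sup>2 * a\<^sup>2 * c\<^sup>2)\<^sup>2)"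
    by (simp add: column_f_def power2_eq_square mult_ac)
  then show ?thesis using assms by simp
qed

lemma eval_act_hom:
  "eval_act (p + p') a c t = eval_act p a c t + eval_act p' a c t"
  "eval_act (p - p') a c t = eval_act p a c t - eval_act p' a c t"
  "eval_act (p * p') a c t = eval_act p a c t * eval_act p' a c t"
  "eval_act (p ^ m) a c t = eval_act p a c t ^ m"
  "eval_act 1 a c t = 1" "eval_act 0 a c t = 0"
  "eval_act [:[:[:0, 1:]:]:] a c t = a" "eval_act [:[:0, 1:]:] a c t = c" "eval_act [:0, 1:] a c t = t"
  by (simp_all add: eval_act_def)

lemma specializes_to_divide:
  assumes "eval_act p' a c t \<noteq> 0"
  shows "specializes_to (to_fract p / to_fract p') a c t (eval_act p a c t / eval_act p' a c t)"
  using assms unfolding specializes_to_def Fract_conv_to_fract by blast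

lemma column_f_specializations:
  fixes q :: complex
  assumes q: "q \<noteq> 0" "norm q < 1"
  shows "specializes_to (column_f var_a var_c var_t var_t) 1 (csqrt q) q 2"
    and "i > 0 \<Longrightarrow> specializes_to (column_f var_a var_c var_t (var_t ^ (i + 1))) 1 (csqrt q) q 1"
proof -
  define a c t :: poly_act where "a = [:[:[:0, 1:]:]:]" and "c = [:[:0, 1:]:]" and "t = [:0, 1:]"
  have var: "var_a = to_fract a" "var_c = to_fract c" "var_t = to_fract t"
    by (simp_all add: var_a_def var_c_def var_t_def a_def c_def t_def)
  have ev: "eval_act a x y z = x" "eval_act c x y z = y" "eval_act t x y z = z" for x y z
    unfolding a_def c_def t_def by (rule eval_act_hom)+
  have nz: "var_a \<noteq> 0" "var_c \<noteq> 0" "var_t \<noteq> 0"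
    by (simp_all add: var a_def c_def t_def)
  have sq: "(csqrt q)\<^sup>2 = q" by simp
  note neq1 = power_neq_one[OF q(2)]
  show "specializes_to (column_f var_a var_c var_t var_t) 1 (csqrt q) q 2"
  proof -
    \<comment> \<open>This common factor vanishes at the point of specialization, so it has to be
      cancelled beforehand. The point \<open>(2, 1, 1)\<close>, where its value is \<open>3\<close>,
      shows that it is not the zero polynomial.\<close>
    have "a\<^sup>2 * c\<^sup>2 - t \<noteq> 0"
    proof
      assume "a\<^sup>2 * c\<^sup>2 - t = 0"
      then have "eval_act (a\<^sup>2 * c\<^sup>2 - t) 2 1 1 = 0" by (simp add: eval_act_hom)
      then show False by (simp add: eval_act_hom ev)
    qed
    then have "var_a\<^sup>2 * var_c\<^sup>2 - var_t \<noteq> 0"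
      by (simp add: var to_fract_power[symmetric] to_fract_mult[symmetric] to_fract_diff[symmetric] del: to_fract_mult to_fract_diff)
    moreover have "column_f var_a var_c var_t var_t
        = ((var_t ^ 3 * (var_a\<^sup>2 * var_c\<^sup>2 - var_t)) * ((var_t - 1) * (var_a\<^sup>2 + 1) * (var_c\<^sup>2 + 1))) /
          ((var_t ^ 3 * (var_a\<^sup>2 * var_c\<^sup>2 - var_t)) * (var_t * var_a\<^sup>2 * var_c\<^sup>2 - 1))"
      unfolding column_f_cleared[OF nz]
      by (rule arg_cong2[of _ _ _ _ "(/)"]) (simp_all add: algebra_simps power2_eq_square power3_eq_cube)
    ultimately have "column_f var_a var_c var_t var_t = ((var_t - 1) * (var_a\<^sup>2 + 1) * (var_c\<^sup>2 + 1)) / (var_t * var_a\<^sup>2 * var_c\<^sup>2 - 1)"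
      using nz by simp
    also have "\<dots> = to_fract ((t - 1) * (a\<^sup>2 + 1) * (c\<^sup>2 + 1)) / to_fract (t * a\<^sup>2 * c\<^sup>2 - 1)"
      by (simp add: var to_fract_power)
    finally have R: "column_f var_a var_c var_t var_t = \<dots>" .
    have den: "q * q - 1 \<noteq> 0"
      using neq1[of 2] by (simp add: power2_eq_square)
    then have "(q - 1) * 2 * (q + 1) / (q * q - 1) = 2"
      by (simp add: field_simps)
    then show ?thesis
      using specializes_to_divide[of "t * a\<^sup>2 * c\<^sup>2 - 1" 1 "csqrt q" q "(t - 1) * (a\<^sup>2 + 1) * (c\<^sup>2 + 1)"] den
      unfolding R by (simp add: eval_act_hom ev sq)
  qed
  assume i: "i > 0"
  define s where "s = q ^ (i + 1)"
  have s1: "s\<^sup>2 \<noteq> 1"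
    using neq1[of "(i + 1) * 2"] unfolding s_def power_mult[symmetric] by simp
  \<comment> \<open>Here \<open>i > 0\<close> enters: for \<open>i = 0\<close> the two squares
    coincide and the denominator vanishes.\<close>
  have s2: "s\<^sup>2 \<noteq> q\<^sup>2"
  proof -
    have "s\<^sup>2 = q\<^sup>2 * q ^ (i * 2)"
      by (simp add: s_def power_mult power_mult_distrib power_add)
    then show ?thesis using neq1[of "i * 2"] q i by simp
  qed
  have R: "column_f var_a var_c var_t (var_t ^ (i + 1))
      = to_fract ((t ^ (i + 1) - 1) * (t ^ (i + 1) * a\<^sup>2 * c\<^sup>2 - t\<^sup>2) * (t ^ (i + 1) * a\<^sup>2 + t) * (t ^ (i + 1) * c\<^sup>2 + t)) /
        to_fract (((t ^ (i + 1))\<^sup>2 * a\<^sup>2 * c\<^sup>2 - t) * ((t ^ (i + 1))\<^sup>2 * a\<^sup>2 * c\<^sup>2 - t ^ 3))"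
    using nz unfolding column_f_cleared[OF nz(1,2) power_not_zero[OF nz(3)]]
    by (simp only: var to_fract_mult to_fract_add to_fract_diff to_fract_power to_fract_1)
  \<comment> \<open>At \<open>a = 1\<close>, \<open>c\<^sup>2 = t = q\<close> the denominator and
    the numerator become the same nonzero expression, whence the value \<open>1\<close>.\<close>
  have den: "(s\<^sup>2 * q - q) * (s\<^sup>2 * q - q ^ 3) = q\<^sup>2 * ((s\<^sup>2 - 1) * (s\<^sup>2 - q\<^sup>2))"
    by (simp add: algebra_simps power2_eq_square power3_eq_cube)
  have num: "(s - 1) * (s * q - q\<^sup>2) * (s + q) * (s * q + q) = q\<^sup>2 * ((s\<^sup>2 - 1) * (s\<^sup>2 - q\<^sup>2))"
    by (simp add: algebra_simps power2_eq_square power3_eq_cube)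
  have "q\<^sup>2 * ((s\<^sup>2 - 1) * (s\<^sup>2 - q\<^sup>2)) \<noteq> 0"
    using q s1 s2 by simp
  then show "specializes_to (column_f var_a var_c var_t (var_t ^ (i + 1))) 1 (csqrt q) q 1"
    using specializes_to_divide[of "((t ^ (i + 1))\<^sup>2 * a\<^sup>2 * c\<^sup>2 - t) * ((t ^ (i + 1))\<^sup>2 * a\<^sup>2 * c\<^sup>2 - t ^ 3)" 1 "csqrt q" q
        "(t ^ (i + 1) - 1) * (t ^ (i + 1) * a\<^sup>2 * c\<^sup>2 - t\<^sup>2) * (t ^ (i + 1) * a\<^sup>2 + t) * (t ^ (i + 1) * c\<^sup>2 + t)"]
    unfolding R by (simp only: eval_act_hom ev s_def[symmetric] sq den num power_one mult_1_right) simp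
qed

theorem corollary1p3:
  fixes n r :: nat and q :: complex
  assumes "n \<ge> 1" and "r \<le> n" and "q \<noteq> 0" and "norm q < 1"
  shows "(\<forall>t. macdonald_DD n r q t = macdonald_CC n r 1 q t)
    \<and> specializes_to (column_f var_a var_c var_t var_t) 1 (csqrt q) q 2
    \<and> (\<forall>i::nat. i > 0 \<longrightarrow>
         specializes_to (column_f var_a var_c var_t (var_t ^ (i + 1))) 1 (csqrt q) q 1)
    \<and> (\<exists>!P. is_koornwinder n 1 (-1) (csqrt q) (- csqrt q) q q (one_column r) P)
    \<and> schur_D n r q = macdonald_DD n r q q
    \<and> macdonald_DD n r q q =
        (\<Sum>k=0..r div 2. of_nat ((n - r + 2 * k) choose k) * orbit_sum n (one_column (r - 2 * k)))"
proof (intro conjI allI impI)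
  show "macdonald_DD n r q t = macdonald_CC n r 1 q t" for t
    \<comment> \<open>Since \<open>csqrt 1 = 1\<close>, the two parameter lists coincide at
      \<open>b = 1\<close>.\<close>
    by (simp add: macdonald_DD_def macdonald_CC_def)
  show "specializes_to (column_f var_a var_c var_t var_t) 1 (csqrt q) q 2"
    by (rule column_f_specializations(1)[OF assms(3,4)])
  show "specializes_to (column_f var_a var_c var_t (var_t ^ (i + 1))) 1 (csqrt q) q 1" if "i > 0" for i
    by (rule column_f_specializations(2)[OF assms(3,4) that])
  show "\<exists>!P. is_koornwinder n 1 (-1) (csqrt q) (- csqrt q) q q (one_column r) P"
    unfolding is_koornwinder_iff_column_poly[OF assms] by simp
  show "schur_D n r q = macdonald_DD n r q q"
    by (rule schur_D_def)
  show "macdonald_DD n r q q =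
      (\<Sum>k=0..r div 2. of_nat ((n - r + 2 * k) choose k) * orbit_sum n (one_column (r - 2 * k)))"
    unfolding macdonald_DD_def koornwinder_def is_koornwinder_iff_column_poly[OF assms]
    by (simp add: column_poly_def)
qed

end
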